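(* Let $k\ge1$ and $n$ be integers and let $1\le s_1<s_2<\ldots<s_k<n$ be integers. Let $G=C_{2n}(s_1,\ldots,s_k,n)$ be the circulant graph and $\widetilde{G}$ the cone over $G$. Then $Jac(\widetilde{G})$ is isomorphic to $$\mathrm{coker}\Big(\mathcal{A}^n-(2k+2)I+\sum_{j=1}^{k}(\mathcal{A}^{s_j}+\mathcal{A}^{-s_j})\Big),$$ where $\mathcal{A}$ is the companion matrix of the bimonic Laurent polynomial $\big(2k+2-\sum_{j=1}^{k}(z^{s_j}+z^{-s_j})\big)^2-1$ and $I$ is the identity matrix of the same size as $\mathcal{A}$.
   Context: The circulant graph $C_{2n}(s_1,\ldots,s_k,n)$ has vertices $0,1,\ldots,2n-1$, with vertex $i$ adjacent to $i\pm s_1,\ldots,i\pm s_k$ and $i+n \pmod{2n}$ (so each vertex has degree $2k+1$). The cone over a graph $G$ is obtained by adding a new vertex joined by a single edge to every vertex of $G$. For a connected graph $H$ on $m$ vertices with Laplacian $L(H)=D(H)-A(H)$, the Jacobian $Jac(H)$ is the torsion subgroup of $\mathbb{Z}^m/\mathrm{im}\,L(H)$. For a bimonic integer Laurent polynomial $P(z)=z^{p}+a_1z^{p+1}+\ldots+a_{s-1}z^{p+s-1}+z^{p+s}$ ($s>0$), its companion matrix is the $s\times s$ integer matrix with first $s-1$ rows $(0\mid I_{s-1})$ and last row $(-1,-a_1,\ldots,-a_{s-1})$; it is invertible over $\mathbb{Z}$. For a square integer matrix $M$ of size $s$, $\mathrm{coker}\,M=\mathbb{Z}^s/\mathrm{im}\,M$.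 *)

theory Defs
  imports
    "Graph_Theory.Pair_Digraph"
    "Jordan_Normal_Form.Matrix"
    "HOL-Algebra.Coset"
    "HOL-Library.Poly_Mapping"
    "HOL-Number_Theory.Cong"
begin

text \<open>A simple graph is a \<^typ>\<open>'a pair_pre_digraph\<close> with a symmetric, irreflexive arc relation,
  each undirected edge being a pair of opposite arcs.\<close>

definition circulant_graph :: "nat \<Rightarrow> nat set \<Rightarrow> nat pair_pre_digraph" where
  "circulant_graph m S =
     \<lparr> pverts = {0..<m},
       parcs = {(i, j). i < m \<and> j < m \<and> (\<exists>t\<in>S. [j = i + t] (mod m) \<or> [i = j + t] (mod m))} \<rparr>"

text \<open>The apex \<open>w\<close> has to be chosen outside of the vertex set.\<close>

definition cone_graph :: "'a \<Rightarrow> 'a pair_pre_digraph \<Rightarrow> 'a pair_pre_digraph" where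
  "cone_graph w G =
     \<lparr> pverts = insert w (pverts G),
       parcs = parcs G \<union> {w} \<times> pverts G \<union> pverts G \<times> {w} \<rparr>"

text \<open>Matrices of a finite graph are indexed by its vertices in increasing order.\<close>

definition vertex :: "'a :: linorder pair_pre_digraph \<Rightarrow> nat \<Rightarrow> 'a" where
  "vertex G i = sorted_list_of_set (pverts G) ! i"

definition degree_mat :: "'a :: linorder pair_pre_digraph \<Rightarrow> int mat" where
  "degree_mat G = mat (card (pverts G)) (card (pverts G))
     (\<lambda>(i, j). if i = j then int (out_degree (with_proj G) (vertex G i)) else 0)"

definition adjacency_mat :: "'a :: linorder pair_pre_digraph \<Rightarrow> int mat" where
  "adjacency_mat G = mat (card (pverts G)) (card (pverts G))
     (\<lambda>(i, j). if (vertex G i, vertex G j) \<in> parcs G then 1 else 0)"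

definition laplacian :: "'a :: linorder pair_pre_digraph \<Rightarrow> int mat" where
  "laplacian G = degree_mat G - adjacency_mat G"

definition coker :: "int mat \<Rightarrow> int vec set monoid" where
  "coker M = monoid_vec TYPE(int) (dim_row M) Mod ((\<lambda>v. M *\<^sub>v v) ` carrier_vec (dim_col M))"

definition torsion_subgroup :: "('a, 'b) monoid_scheme \<Rightarrow> ('a, 'b) monoid_scheme" where
  "torsion_subgroup H =
     H\<lparr>carrier := {x \<in> carrier H. \<exists>m::nat. m > 0 \<and> x [^]\<^bsub>H\<^esub> m = \<one>\<^bsub>H\<^esub>}\<rparr>"

definition Jac :: "'a :: linorder pair_pre_digraph \<Rightarrow> int vec set monoid" where
  "Jac G = torsion_subgroup (coker (laplacian G))"

text \<open>Integer Laurent polynomials: finitely supported functions on the exponents, multiplied by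
  convolution. The coefficient of \<open>z\<^sup>i\<close> in \<open>P\<close> is \<open>lookup P i\<close>.\<close>

type_synonym laurent_poly = "int \<Rightarrow>\<^sub>0 int"

definition zpow :: "int \<Rightarrow> laurent_poly" where
  "zpow i = Poly_Mapping.single i 1"

definition low_exp :: "laurent_poly \<Rightarrow> int" where
  "low_exp P = Min (Poly_Mapping.keys P)"

definition laurent_span :: "laurent_poly \<Rightarrow> nat" where
  "laurent_span P = nat (Max (Poly_Mapping.keys P) - low_exp P)"

text \<open>Only meaningful for bimonic \<open>P\<close> of positive span: the extreme coefficients are \<open>1\<close>, so the
  last row starts with \<open>-1\<close> and the matrix is invertible over the integers.\<close>

definition companion_mat :: "laurent_poly \<Rightarrow> int mat" where
  "companion_mat P = mat (laurent_span P) (laurent_span P)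
     (\<lambda>(i, j). if i + 1 < laurent_span P then (if j = i + 1 then 1 else 0)
               else - Poly_Mapping.lookup P (low_exp P + int j))"

text \<open>For a negative exponent, this is a power of the inverse in the ring of integer matrices.\<close>

definition mat_zpow :: "int mat \<Rightarrow> int \<Rightarrow> int mat" where
  "mat_zpow A e = A [^]\<^bsub>ring_mat TYPE(int) (dim_row A) ()\<^esub> e"

definition mat_sum :: "nat \<Rightarrow> ('i \<Rightarrow> int mat) \<Rightarrow> 'i set \<Rightarrow> int mat" where
  "mat_sum d f I = finsum (ring_mat TYPE(int) d ()) f I"

end

theory Submission
  imports
    Defs
    "Jordan_Normal_Form.Determinant"
    "HOL-Algebra.Multiplicative_Group"
begin

text \<open>Let \<open>R\<close> be the ring of integer Laurent polynomials, \<open>Q = 2k + 2 - \<Sum>\<^sub>j (z\<^bsup>s j\<^esup> + z\<^bsup>-s j\<^esup>)\<close> and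
  \<open>E = Q - z\<^sup>n\<close>. Sending \<open>z\<^sup>i\<close> to the difference of the vertex \<open>i mod 2n\<close> and the apex maps \<open>R\<close>
  onto the integer vectors of sum zero, with kernel \<open>(z\<^sup>2\<^sup>n - 1)\<close>, and carries \<open>E R\<close> onto the image of
  the Laplacian of the cone. The cokernel of the Laplacian restricted to vectors of sum zero is
  finite, so the Jacobian is \<open>R / (z\<^sup>2\<^sup>n - 1, E)\<close>. On the other side, \<open>R / (Q\<^sup>2 - 1)\<close> is a free
  abelian group on which multiplication by \<open>z\<close> is the companion matrix, so the matrix of the theorem
  is multiplication by \<open>-E\<close> and its cokernel is \<open>R / (Q\<^sup>2 - 1, E)\<close>. Both ideals agree because
  \<open>(Q\<^sup>2 - 1) - (z\<^sup>2\<^sup>n - 1) = E (Q + z\<^sup>n)\<close>.\<close>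

section \<open>Linear functionals on Laurent polynomials\<close>

abbreviation lookup :: "laurent_poly \<Rightarrow> int \<Rightarrow> int" where
  "lookup \<equiv> Poly_Mapping.lookup"

abbreviation keys :: "laurent_poly \<Rightarrow> int set" where
  "keys \<equiv> Poly_Mapping.keys"

lemma zpow_mult: "zpow i * zpow j = zpow (i + j)"
  by (simp add: zpow_def mult_single)

lemma zpow_0 [simp]: "zpow 0 = 1"
  by (simp add: zpow_def)

lemma zpow_power: "zpow i ^ m = zpow (int m * i)"
  by (induction m) (simp_all add: zpow_mult algebra_simps)

lemma lookup_zpow: "lookup (zpow i) j = of_bool (j = i)"
  by (auto simp: zpow_def lookup_single when_def)

text \<open>Laurent polynomials form the free abelian group on the exponents, and closure under
  differences also yields sums and negatives. An identity additive in \<open>f\<close> therefore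
  needs checking on monomials only.\<close>

lemma laurent_induct [case_names zpow diff]:
  assumes "\<And>i. Q (zpow i)" and "\<And>f g. Q f \<Longrightarrow> Q g \<Longrightarrow> Q (f - g)"
  shows "Q f"
proof (rule frag_induction[of f UNIV])
  show "Q 0"
    using assms(2)[OF assms(1) assms(1), of 0 0] by simp
qed (use assms in \<open>auto simp: zpow_def\<close>)

lemma keys_subset_iff: "keys f \<subseteq> S \<longleftrightarrow> (\<forall>i. i \<notin> S \<longrightarrow> lookup f i = 0)"
  by (auto simp: in_keys_iff)

text \<open>The additive functional with value \<open>h i\<close> on \<open>zpow i\<close>.
  Coefficients, sums over residue classes and the value of \<open>f\<close> at 1 (\<open>h\<close>
  constantly 1) are all instances.\<close>

definition pairing :: "(int \<Rightarrow> int) \<Rightarrow> laurent_poly \<Rightarrow> int" where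
  "pairing h f = (\<Sum>i\<in>keys f. lookup f i * h i)"

lemma pairing_superset:
  assumes "finite S" "keys f \<subseteq> S"
  shows "pairing h f = (\<Sum>i\<in>S. lookup f i * h i)"
  unfolding pairing_def using assms
  by (intro sum.mono_neutral_left) (auto simp: in_keys_iff)

lemma pairing_diff: "pairing h (f - g) = pairing h f - pairing h g"
proof -
  let ?S = "keys f \<union> keys g"
  have "keys (f - g) \<subseteq> ?S" by (rule keys_diff)
  then show ?thesis
    by (simp add: pairing_superset[of ?S] lookup_minus left_diff_distrib sum_subtractf)
qed

lemma pairing_0 [simp]: "pairing h 0 = 0"
  by (simp add: pairing_def)

lemma pairing_uminus: "pairing h (- f) = - pairing h f"
  using pairing_diff[of h 0 f] by simp

lemma pairing_add: "pairing h (f + g) = pairing h f + pairing h g"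
  using pairing_diff[of h f "- g"] by (simp add: pairing_uminus)

lemma pairing_sum: "pairing h (sum f I) = (\<Sum>i\<in>I. pairing h (f i))"
  by (induction I rule: infinite_finite_induct) (simp_all add: pairing_add)

lemma pairing_zpow [simp]: "pairing h (zpow i) = h i"
  by (simp add: pairing_def zpow_def)

lemma pairing_frag_cmul: "pairing h (frag_cmul c f) = c * pairing h f"
proof -
  have "pairing h (frag_cmul c f) = (\<Sum>i\<in>keys f. lookup (frag_cmul c f) i * h i)"
    by (rule pairing_superset) (auto intro: keys_cmul)
  then show ?thesis
    by (simp add: pairing_def sum_distrib_left mult.assoc)
qed

lemma pairing_shift: "pairing h (zpow t * f) = pairing (\<lambda>i. h (t + i)) f"
  by (induction f rule: laurent_induct)
     (simp_all add: zpow_mult right_diff_distrib pairing_diff)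

text \<open>Both sides are additive and agree on monomials. Additivity alone thus brings
  compatibility with integer scalars and an expansion of products along their first factor.\<close>

lemma additive_eq_pairing:
  assumes "\<And>f g. F (f - g) = F f - F g"
  shows "F f = pairing (\<lambda>i. F (zpow i)) f"
  by (induction f rule: laurent_induct) (simp_all add: assms pairing_diff)

lemma lookup_eq_pairing: "lookup f k = pairing (\<lambda>i. of_bool (k = i)) f"
  using additive_eq_pairing[of "\<lambda>f. lookup f k" f] by (simp add: lookup_minus lookup_zpow)

lemma lookup_zpow_mult [simp]: "lookup (zpow t * f) k = lookup f (k - t)"
proof -
  have "k = t + i \<longleftrightarrow> k - t = i" for i by auto
  then show ?thesis by (simp add: lookup_eq_pairing[of _ k] lookup_eq_pairing[of _ "k - t"] pairing_shift)
qed

lemma lookup_mult_pairing: "lookup (f * g) k = pairing (\<lambda>j. lookup g (k - j)) f"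
  using additive_eq_pairing[of "\<lambda>f. lookup (f * g) k" f]
  by (simp add: lookup_minus left_diff_distrib)

text \<open>An integer scalar is a constant polynomial, so ring facts about divisibility and
  commutativity reach \<open>frag_cmul\<close>.\<close>

lemma frag_cmul_eq_mult: "frag_cmul c f = frag_cmul c 1 * f" for f :: laurent_poly
  using pairing_zpow[of _ 0] by (intro poly_mapping_eqI) (simp add: lookup_mult_pairing pairing_frag_cmul)

lemma mult_frag_cmul: "g * frag_cmul c f = frag_cmul c (g * f)" for f :: laurent_poly
  by (simp only: frag_cmul_eq_mult[of c f] frag_cmul_eq_mult[of c "g * f"] mult.left_commute)

text \<open>Within the two intervals only one pair of exponents adds up to an extreme exponent of
  the product, so nothing can cancel there.\<close>

lemma
  assumes "keys f \<subseteq> {a..b}" "keys g \<subseteq> {a'..b'}"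
  shows lookup_mult_upper: "lookup (f * g) (b + b') = lookup f b * lookup g b'"
    and lookup_mult_lower: "lookup (f * g) (a + a') = lookup f a * lookup g a'"
    and keys_mult_interval: "keys (f * g) \<subseteq> {a + a'..b + b'}"
proof -
  have f: "lookup f i = 0" if "i \<notin> {a..b}" for i
    using assms(1) that by (auto simp: keys_subset_iff)
  have g: "lookup g i = 0" if "i \<notin> {a'..b'}" for i
    using assms(2) that by (auto simp: keys_subset_iff)
  have "(\<Sum>i\<in>keys f. lookup f i * lookup g (b + b' - i)) =
        (\<Sum>i\<in>keys f. if i = b then lookup f b * lookup g b' else 0)"
  proof (rule sum.cong)
    fix i assume "i \<in> keys f"
    then have "i \<le> b" using assms(1) by auto
    then show "lookup f i * lookup g (b + b' - i) = (if i = b then lookup f b * lookup g b' else 0)"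
      by (auto simp: g)
  qed simp
  then show "lookup (f * g) (b + b') = lookup f b * lookup g b'"
    by (auto simp: lookup_mult_pairing pairing_def in_keys_iff)
  have "(\<Sum>i\<in>keys f. lookup f i * lookup g (a + a' - i)) =
        (\<Sum>i\<in>keys f. if i = a then lookup f a * lookup g a' else 0)"
  proof (rule sum.cong)
    fix i assume "i \<in> keys f"
    then have "a \<le> i" using assms(1) by auto
    then show "lookup f i * lookup g (a + a' - i) = (if i = a then lookup f a * lookup g a' else 0)"
      by (auto simp: g)
  qed simp
  then show "lookup (f * g) (a + a') = lookup f a * lookup g a'"
    by (auto simp: lookup_mult_pairing pairing_def in_keys_iff)
  show "keys (f * g) \<subseteq> {a + a'..b + b'}"
    using keys_mult[of f g] assms by fastforce
qed

section \<open>Laurent polynomials modulo a bimonic one\<close>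

text \<open>A monomial factor is a unit, so a bimonic polynomial can be normalised to have lowest
  exponent 0; \<open>d\<close> is then its span.\<close>

locale bimonic =
  fixes P :: laurent_poly and d :: nat
  assumes span_pos: "0 < d"
    and keys_P: "keys P \<subseteq> {0..int d}"
    and lookup_P_0: "lookup P 0 = 1"
    and lookup_P_d: "lookup P (int d) = 1"
begin

section \<open>Division with remainder\<close>

lemma dvd_small_eq_0:
  assumes "P dvd r" "keys r \<subseteq> {0..<int d}"
  shows "r = 0"
proof (rule ccontr)
  assume "r \<noteq> 0"
  obtain q where r: "r = P * q" using assms(1) by (rule dvdE)
  with \<open>r \<noteq> 0\<close> have ne: "keys q \<noteq> {}" by auto
  let ?a = "Min (keys q)" and ?b = "Max (keys q)"
  have q: "keys q \<subseteq> {?a..?b}" by auto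
  have "?a \<in> keys q" "?b \<in> keys q" using ne by auto
  then have "?a \<le> ?b" "lookup q ?a \<noteq> 0" "lookup q ?b \<noteq> 0" by (auto simp: in_keys_iff)
  \<comment> \<open>Both extreme coefficients of \<open>P\<close> are 1, so the extreme terms of
    \<open>q\<close> survive in \<open>r\<close>, at least \<open>d\<close> apart.\<close>
  moreover have "lookup r (int d + ?b) = lookup q ?b" "lookup r (0 + ?a) = lookup q ?a"
    unfolding r using lookup_mult_upper[OF keys_P q] lookup_mult_lower[OF keys_P q]
    by (simp_all add: lookup_P_0 lookup_P_d)
  ultimately have "int d + ?b \<in> keys r" "?a \<in> keys r"
    by (auto simp: in_keys_iff)
  then have "int d + ?b < int d" "0 \<le> ?a" using assms(2) by auto
  then show False using \<open>?a \<le> ?b\<close> by linarith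
qed

text \<open>The polynomials that have a remainder include 1 and are closed under differences and
  under multiplication by \<open>zpow 1\<close> and \<open>zpow (- 1)\<close>, hence they are all
  polynomials.\<close>

lemma remainder_exists: "\<exists>r. keys r \<subseteq> {0..<int d} \<and> P dvd f - r"
proof -
  define R where "R f = (\<exists>r. keys r \<subseteq> {0..<int d} \<and> P dvd f - r)" for f
  have diff: "R (f - g)" if fg: "R f" "R g" for f g
  proof -
    obtain r where r: "keys r \<subseteq> {0..<int d}" "P dvd f - r" using fg(1) R_def by auto
    obtain r' where r': "keys r' \<subseteq> {0..<int d}" "P dvd g - r'" using fg(2) R_def by auto
    have "P dvd (f - g) - (r - r')"
      using dvd_diff[OF r(2) r'(2)] by (simp add: algebra_simps)
    moreover have "keys (r - r') \<subseteq> {0..<int d}"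
      using keys_diff[of r r'] r(1) r'(1) by blast
    ultimately show ?thesis unfolding R_def by blast
  qed
  \<comment> \<open>Shifting a remainder by one pushes at most one term out of the window
    \<open>{0..<int d}\<close>; the multiple \<open>c r\<close> of a shifted \<open>P\<close> has to
    cancel that term.\<close>
  have reduce: "R (zpow t * f)"
    if f: "R f" and "\<And>r. keys r \<subseteq> {0..<int d} \<Longrightarrow>
        keys (zpow t * r - frag_cmul (c r) (zpow u * P)) \<subseteq> {0..<int d}" for t u f c
  proof -
    obtain r where r: "keys r \<subseteq> {0..<int d}" "P dvd f - r" using f R_def by auto
    have "P dvd zpow t * (f - r) + frag_cmul (c r) (zpow u * P)"
      by (subst frag_cmul_eq_mult) (intro dvd_add dvd_mult r(2), simp)
    then have "P dvd zpow t * f - (zpow t * r - frag_cmul (c r) (zpow u * P))"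
      by (simp add: algebra_simps)
    with that(2)[OF r(1)] show ?thesis unfolding R_def by blast
  qed
  \<comment> \<open>The term pushed out sits at exponent \<open>d\<close>, where \<open>P\<close>
    has coefficient 1.\<close>
  have up: "R (zpow 1 * f)" if "R f" for f
    using that
  proof (rule reduce[where u = 0 and c = "\<lambda>r. lookup r (int d - 1)"])
    fix r assume "keys r \<subseteq> {0..<int d}"
    then have r: "lookup r i = 0" if "i \<notin> {0..<int d}" for i
      using that by (auto simp: keys_subset_iff)
    have P: "lookup P i = 0" if "i \<notin> {0..int d}" for i
      using that keys_P by (auto simp: keys_subset_iff)
    show "keys (zpow 1 * r - frag_cmul (lookup r (int d - 1)) (zpow 0 * P)) \<subseteq> {0..<int d}"
      unfolding keys_subset_iff
    proof (intro allI impI)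
      fix i assume "i \<notin> {0..<int d}"
      then consider "i < 0" | "i = int d" | "int d < i" by fastforce
      then show "lookup (zpow 1 * r - frag_cmul (lookup r (int d - 1)) (zpow 0 * P)) i = 0"
        by cases (simp_all add: lookup_minus lookup_P_d r P)
    qed
  qed
  \<comment> \<open>The term pushed out sits at exponent -1, where the lowest term of
    \<open>zpow (- 1) * P\<close> has coefficient 1.\<close>
  have down: "R (zpow (- 1) * f)" if "R f" for f
    using that
  proof (rule reduce[where u = "- 1" and c = "\<lambda>r. lookup r 0"])
    fix r assume "keys r \<subseteq> {0..<int d}"
    then have r: "lookup r i = 0" if "i \<notin> {0..<int d}" for i
      using that by (auto simp: keys_subset_iff)
    have P: "lookup P i = 0" if "i \<notin> {0..int d}" for i
      using that keys_P by (auto simp: keys_subset_iff)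
    show "keys (zpow (- 1) * r - frag_cmul (lookup r 0) (zpow (- 1) * P)) \<subseteq> {0..<int d}"
      unfolding keys_subset_iff
    proof (intro allI impI)
      fix i assume "i \<notin> {0..<int d}"
      then consider "i = - 1" | "i < - 1" | "int d \<le> i" by fastforce
      then show "lookup (zpow (- 1) * r - frag_cmul (lookup r 0) (zpow (- 1) * P)) i = 0"
        by cases (simp_all add: lookup_minus lookup_P_0 r P)
    qed
  qed
  have "R 1"
    unfolding R_def using span_pos by (intro exI[of _ 1]) simp
  have nonneg: "R (zpow (int m))" for m
  proof (induction m)
    case (Suc m)
    then show ?case using up[of "zpow (int m)"] by (simp add: zpow_mult)
  qed (use \<open>R 1\<close> in simp)
  have neg: "R (zpow (- int m))" for m
  proof (induction m)
    case (Suc m)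
    then show ?case using down[of "zpow (- int m)"] by (simp add: zpow_mult)
  qed (use \<open>R 1\<close> in simp)
  have "R (zpow i)" for i
    using nonneg neg by (cases i rule: int_cases2) auto
  then have "R f"
    by (induction f rule: laurent_induct) (auto intro: diff)
  then show ?thesis unfolding R_def .
qed

lemma remainder_unique:
  assumes "keys r \<subseteq> {0..<int d}" "P dvd f - r" "keys r' \<subseteq> {0..<int d}" "P dvd f - r'"
  shows "r = r'"
proof -
  have "P dvd r - r'"
    using dvd_diff[OF assms(4) assms(2)] by simp
  moreover have "keys (r - r') \<subseteq> {0..<int d}"
    using keys_diff[of r r'] assms(1,3) by blast
  ultimately show ?thesis using dvd_small_eq_0 by force
qed

definition remainder :: "laurent_poly \<Rightarrow> laurent_poly" where
  "remainder f = (THE r. keys r \<subseteq> {0..<int d} \<and> P dvd f - r)"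

lemma remainder_eqI: "remainder f = r" if "keys r \<subseteq> {0..<int d}" "P dvd f - r"
  unfolding remainder_def using that remainder_unique by (intro the_equality) blast+

lemma
  shows keys_remainder: "keys (remainder f) \<subseteq> {0..<int d}"
    and dvd_diff_remainder: "P dvd f - remainder f"
  using remainder_exists[of f] remainder_eqI by blast+

text \<open>The sequence \<open>i \<mapsto> top_coeff (z\<^sup>i)\<close> satisfies the linear recurrence given by \<open>P\<close>, so the
  companion matrix shifts its windows of length \<open>d\<close>.\<close>

definition top_coeff :: "laurent_poly \<Rightarrow> int" where
  "top_coeff f = lookup (remainder f) (int d - 1)"

lemma top_coeff_diff: "top_coeff (f - g) = top_coeff f - top_coeff g"
proof -
  have "P dvd (f - g) - (remainder f - remainder g)"
    using dvd_diff[OF dvd_diff_remainder[of f] dvd_diff_remainder[of g]] by (simp add: algebra_simps)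
  moreover have "keys (remainder f - remainder g) \<subseteq> {0..<int d}"
    using keys_diff[of "remainder f" "remainder g"] keys_remainder by blast
  ultimately have "remainder (f - g) = remainder f - remainder g"
    by (intro remainder_eqI)
  then show ?thesis
    by (simp add: top_coeff_def lookup_minus)
qed

lemma top_coeff_eq_lookup: "top_coeff f = lookup f (int d - 1)" if "keys f \<subseteq> {0..<int d}"
  using remainder_eqI[OF that, of f] by (simp add: top_coeff_def)

lemma top_coeff_multiple: "top_coeff f = 0" if "P dvd f"
  using remainder_eqI[of 0 f] that by (simp add: top_coeff_def)

lemma top_coeff_cong: "top_coeff f = top_coeff g" if "P dvd f - g"
  using top_coeff_multiple[OF that] by (simp add: top_coeff_diff)

lemma top_coeff_add: "top_coeff (f + g) = top_coeff f + top_coeff g"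
  using top_coeff_diff[of "f + g" g] by simp

lemma top_coeff_frag_cmul: "top_coeff (frag_cmul c f) = c * top_coeff f"
  using additive_eq_pairing[of top_coeff, OF top_coeff_diff] by (metis pairing_frag_cmul)

lemma top_coeff_mult: "top_coeff (f * g) = pairing (\<lambda>j. top_coeff (zpow j * g)) f"
  using additive_eq_pairing[of "\<lambda>f. top_coeff (f * g)" f]
  by (simp add: top_coeff_diff left_diff_distrib)

text \<open>\<open>P * f\<close> vanishes modulo \<open>P\<close>; its top coefficient, expanded
  along the terms of \<open>P\<close>, is this sum.\<close>

lemma recurrence: "(\<Sum>j\<in>{0..d}. lookup P (int j) * top_coeff (zpow (int j) * f)) = 0"
proof -
  have "0 = top_coeff (P * f)" by (simp add: top_coeff_multiple)
  also have "\<dots> = (\<Sum>j\<in>int ` {0..d}. lookup P j * top_coeff (zpow j * f))"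
    unfolding top_coeff_mult[of P f] using keys_P
    by (intro pairing_superset) (auto simp: image_int_atLeastAtMost)
  also have "\<dots> = (\<Sum>j\<in>{0..d}. lookup P (int j) * top_coeff (zpow (int j) * f))"
    by (subst sum.reindex) auto
  finally show ?thesis by simp
qed

text \<open>Windows of the recurrent sequence serve as coordinates modulo \<open>P\<close>, because
  the companion matrix acts on them as multiplication by \<open>zpow 1\<close>. On the coefficients
  of the remainder its transpose would act instead.\<close>

definition coords :: "laurent_poly \<Rightarrow> int vec" where
  "coords f = vec d (\<lambda>j. top_coeff (zpow (int j) * f))"

lemma dim_coords [simp]: "dim_vec (coords f) = d"
  by (simp add: coords_def)

lemma coords_carrier [simp]: "coords f \<in> carrier_vec d"
  by (simp add: coords_def)

lemma coords_diff: "coords (f - g) = coords f - coords g"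
  by (rule eq_vecI) (auto simp: coords_def right_diff_distrib top_coeff_diff)

lemma coords_add: "coords (f + g) = coords f + coords g"
  by (rule eq_vecI) (auto simp: coords_def distrib_left top_coeff_add)

text \<open>A nonzero remainder can be multiplied by a power of \<open>zpow 1\<close> below
  \<open>d\<close> that moves its leading term to exponent \<open>d - 1\<close> and keeps all terms
  in the window. The corresponding coordinate is the leading coefficient, which is not 0.\<close>

lemma coords_eq_0_iff: "coords f = 0\<^sub>v d \<longleftrightarrow> P dvd f"
proof
  assume "P dvd f"
  then show "coords f = 0\<^sub>v d"
    by (intro eq_vecI) (auto simp: coords_def intro: top_coeff_multiple)
next
  assume f: "coords f = 0\<^sub>v d"
  define r where "r = remainder f"
  have "r = 0"
  proof (rule ccontr)
    assume "r \<noteq> 0"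
    then have max: "Max (keys r) \<in> keys r" by (intro Max_in) auto
    define b where "b = Max (keys r)"
    have b: "0 \<le> b" "b < int d" "lookup r b \<noteq> 0"
      using max keys_remainder[of f] by (auto simp: in_keys_iff r_def b_def)
    define j where "j = nat (int d - 1 - b)"
    have j: "int j = int d - 1 - b" "j < d" using b by (auto simp: j_def)
    have "keys (zpow (int j) * r) \<subseteq> {0..<int d}"
      unfolding keys_subset_iff
    proof (intro allI impI)
      fix i assume i: "i \<notin> {0..<int d}"
      show "lookup (zpow (int j) * r) i = 0"
      proof (rule ccontr)
        assume "lookup (zpow (int j) * r) i \<noteq> 0"
        then have "i - int j \<in> keys r" by (simp add: in_keys_iff)
        then have "i - int j \<le> b" "0 \<le> i - int j"
          using keys_remainder[of f] by (auto simp: r_def b_def)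
        with i j b show False by auto
      qed
    qed
    then have "top_coeff (zpow (int j) * r) = lookup r b"
      using j by (simp add: top_coeff_eq_lookup)
    moreover have "P dvd zpow (int j) * f - zpow (int j) * r"
      unfolding right_diff_distrib[symmetric] r_def by (intro dvd_mult dvd_diff_remainder)
    then have "top_coeff (zpow (int j) * r) = coords f $ j"
      using j by (simp add: coords_def top_coeff_cong)
    ultimately show False using b f j by simp
  qed
  then show "P dvd f" using dvd_diff_remainder[of f] by (simp add: r_def)
qed

text \<open>The Hankel matrix with the entries \<open>top_coeff (z\<^sup>i\<^sup>+\<^sup>j)\<close> is triangular with respect to the
  antidiagonal, where it is \<open>1\<close>: solve for the coordinates one after the other.\<close>

lemma coords_surj:
  assumes v: "v \<in> carrier_vec d"
  shows "\<exists>f. coords f = v"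
proof -
  have "\<exists>f. \<forall>j<m. top_coeff (zpow (int j) * f) = v $ j" if "m \<le> d" for m
    using that
  proof (induction m)
    case (Suc m)
    then obtain f where f: "top_coeff (zpow (int j) * f) = v $ j" if "j < m" for j by auto
    \<comment> \<open>\<open>c\<close> is the defect at index \<open>m\<close>. The correcting
      monomial has top coefficient 1 after a shift by \<open>m\<close> and 0 after any smaller
      shift, so the entries already solved stay intact.\<close>
    define c where "c = v $ m - top_coeff (zpow (int m) * f)"
    define g where "g = f + frag_cmul c (zpow (int (d - 1 - m)))"
    have *: "top_coeff (zpow (int j)) = of_bool (j = d - 1)" if "j < d" for j
      using that span_pos
      by (subst top_coeff_eq_lookup) (auto simp: zpow_def lookup_single when_def)
    have "top_coeff (zpow (int j) * g) = v $ j" if "j \<le> m" for j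
    proof -
      have "int j + int (d - 1 - m) = int (j + (d - 1 - m))" by simp
      moreover have "j + (d - 1 - m) < d" "j + (d - 1 - m) = d - 1 \<longleftrightarrow> j = m"
        using that Suc.prems by auto
      ultimately have "top_coeff (zpow (int j) * g) = top_coeff (zpow (int j) * f) + c * of_bool (j = m)"
        using *[of "j + (d - 1 - m)"]
        by (simp only: g_def distrib_left mult_frag_cmul top_coeff_add top_coeff_frag_cmul zpow_mult)
      then show ?thesis using that f[of j] by (auto simp: c_def)
    qed
    then show ?case by (auto simp: less_Suc_eq_le)
  qed simp
  from this[of d] obtain f where "top_coeff (zpow (int j) * f) = v $ j" if "j < d" for j by auto
  then have "coords f = v"
    using v by (intro eq_vecI) (auto simp: coords_def)
  then show ?thesis ..
qed

end

section \<open>The companion matrix\<close>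

context bimonic
begin

definition companion :: "int mat" where
  "companion = mat d d
     (\<lambda>(i, j). if i + 1 < d then (if j = i + 1 then 1 else 0) else - lookup P (int j))"

text \<open>Moves windows one place back: the first row solves the recurrence for its lowest term,
  whose coefficient is 1.\<close>

definition companion_inv :: "int mat" where
  "companion_inv = mat d d
     (\<lambda>(i, j). if i = 0 then - lookup P (int j + 1) else if j = i - 1 then 1 else 0)"

lemma companion_carrier [simp]: "companion \<in> carrier_mat d d" "companion_inv \<in> carrier_mat d d"
  by (simp_all add: companion_def companion_inv_def)

text \<open>All rows but the last read off the next entry of the window; the last row computes the
  entry that enters it from the recurrence.\<close>

lemma companion_coords: "companion *\<^sub>v coords f = coords (zpow 1 * f)"
proof (rule eq_vecI)
  fix i assume "i < dim_vec (coords (zpow 1 * f))"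
  then have i: "i < d" by simp
  let ?x = "\<lambda>j. top_coeff (zpow (int j) * f)"
  have shift: "coords (zpow 1 * f) $ i = ?x (i + 1)"
    using i by (simp add: coords_def zpow_mult add.commute flip: mult.assoc)
  have "(companion *\<^sub>v coords f) $ i = (\<Sum>j<d. companion $$ (i, j) * ?x j)"
    using i by (simp add: scalar_prod_def coords_def companion_def lessThan_atLeast0)
  also have "\<dots> = ?x (i + 1)"
  proof (cases "i + 1 < d")
    case True
    then have "(\<Sum>j<d. companion $$ (i, j) * ?x j) = (\<Sum>j<d. if j = i + 1 then ?x j else 0)"
      using i by (intro sum.cong) (auto simp: companion_def)
    then show ?thesis using True by simp
  next
    case False
    with i have "i + 1 = d" by simp
    have "(\<Sum>j<d. companion $$ (i, j) * ?x j) = - (\<Sum>j<d. lookup P (int j) * ?x j)"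
      using i False by (simp add: companion_def sum_negf)
    also have "\<dots> = ?x d"
      using recurrence[of f] by (simp add: atLeast0AtMost lookup_P_d flip: lessThan_Suc_atMost)
    finally show ?thesis using \<open>i + 1 = d\<close> by simp
  qed
  finally show "(companion *\<^sub>v coords f) $ i = coords (zpow 1 * f) $ i"
    using shift by simp
qed (simp add: companion_def)

lemma companion_inv_coords: "companion_inv *\<^sub>v coords f = coords (zpow (- 1) * f)"
proof (rule eq_vecI)
  fix i assume "i < dim_vec (coords (zpow (- 1) * f))"
  then have i: "i < d" by simp
  let ?x = "\<lambda>j. top_coeff (zpow (int j) * f)"
  let ?y = "\<lambda>j. top_coeff (zpow (int j) * (zpow (- 1) * f))"
  have y: "?y (Suc j) = ?x j" for j
    by (simp add: zpow_mult flip: mult.assoc)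
  have "(companion_inv *\<^sub>v coords f) $ i = (\<Sum>j<d. companion_inv $$ (i, j) * ?x j)"
    using i by (simp add: scalar_prod_def coords_def companion_inv_def lessThan_atLeast0)
  also have "\<dots> = ?y i"
  proof (cases i)
    case (Suc i')
    then have "(\<Sum>j<d. companion_inv $$ (i, j) * ?x j) = (\<Sum>j<d. if j = i' then ?x j else 0)"
      using i by (intro sum.cong) (auto simp: companion_inv_def)
    then show ?thesis using Suc i y by simp
  next
    case 0
    have "(\<Sum>j<d. companion_inv $$ (i, j) * ?x j) = - (\<Sum>j<d. lookup P (int (Suc j)) * ?y (Suc j))"
      using i 0 unfolding y by (simp add: companion_inv_def sum_negf add.commute)
    also have "\<dots> = ?y 0"
    proof -
      have "(\<Sum>j\<in>{0..d}. lookup P (int j) * ?y j) = 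
        lookup P (int 0) * ?y 0 + (\<Sum>j<d. lookup P (int (Suc j)) * ?y (Suc j))"
        by (simp only: atLeast0AtMost lessThan_Suc_atMost[symmetric] sum.lessThan_Suc_shift)
      then show ?thesis
        using recurrence[of "zpow (- 1) * f"] lookup_P_0 by simp
    qed
    finally show ?thesis using 0 by simp
  qed
  finally show "(companion_inv *\<^sub>v coords f) $ i = coords (zpow (- 1) * f) $ i"
    using i by (simp add: coords_def)
qed (simp add: companion_inv_def)

text \<open>Every unit vector is a coordinate vector by \<open>coords_surj\<close>, and the images
  of these are the columns.\<close>

lemma mat_eq_if_coords:
  assumes "A \<in> carrier_mat m d" "B \<in> carrier_mat m d"
    and eq: "\<And>f. A *\<^sub>v coords f = B *\<^sub>v coords f"
  shows "A = B"
proof (rule eq_matI)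
  fix i j assume ij: "i < dim_row B" "j < dim_col B"
  obtain f where f: "coords f = unit_vec d j" using coords_surj[of "unit_vec d j"] by auto
  have "(A *\<^sub>v unit_vec d j) $ i = (B *\<^sub>v unit_vec d j) $ i"
    using eq[of f] by (simp add: f)
  then show "A $$ (i, j) = B $$ (i, j)"
    using assms(1,2) ij by (simp add: scalar_prod_right_unit[of _ d])
qed (use assms(1,2) in auto)

abbreviation "Mat \<equiv> ring_mat TYPE(int) d ()"

text \<open>Both products act on coordinates as multiplication by \<open>zpow 0\<close>. Being a
  unit is what gives negative powers in \<open>mat_zpow\<close> their meaning.\<close>

lemma companion_Units: "companion \<in> Units Mat"
proof -
  have "companion * companion_inv = 1\<^sub>m d"
    by (rule mat_eq_if_coords[where m = d])
       (simp_all add: mult_carrier_mat[of _ d d] assoc_mult_mat_vec[of _ d d _ d] companion_coords companion_inv_coords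
         zpow_mult flip: mult.assoc)
  moreover have "companion_inv * companion = 1\<^sub>m d"
    by (rule mat_eq_if_coords[where m = d])
       (simp_all add: mult_carrier_mat[of _ d d] assoc_mult_mat_vec[of _ d d _ d] companion_coords companion_inv_coords
         zpow_mult flip: mult.assoc)
  ultimately show ?thesis
    by (auto simp: Units_def ring_mat_simps)
qed

lemma mat_zpow_carrier: "mat_zpow companion e \<in> carrier_mat d d"
  and mat_zpow_coords: "mat_zpow companion e *\<^sub>v coords f = coords (zpow e * f)"
proof -
  interpret ring Mat by (rule ring_mat)
  have dim: "dim_row companion = d" by (simp add: companion_def)
  have pow_carrier: "companion [^]\<^bsub>Mat\<^esub> m \<in> carrier_mat d d" for m :: nat
    using nat_pow_closed[of companion m] by (simp add: ring_mat_simps)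
  have pow_coords: "companion [^]\<^bsub>Mat\<^esub> m *\<^sub>v coords f = coords (zpow (int m) * f)" for m :: nat and f
  proof (induction m arbitrary: f)
    case (Suc m)
    have "companion [^]\<^bsub>Mat\<^esub> Suc m *\<^sub>v coords f =
        companion [^]\<^bsub>Mat\<^esub> m *\<^sub>v (companion *\<^sub>v coords f)"
      using pow_carrier[of m] by (simp add: ring_mat_simps assoc_mult_mat_vec[of _ d d _ d])
    then show ?case
      by (simp add: companion_coords Suc zpow_mult add.commute flip: mult.assoc)
  qed (simp add: ring_mat_simps)
  have "mat_zpow companion e \<in> carrier_mat d d \<and>
      mat_zpow companion e *\<^sub>v coords f = coords (zpow e * f)"
  proof (cases "e < 0")
    case False
    then obtain m where "e = int m" by (metis nonneg_int_cases not_less)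
    then show ?thesis
      using pow_carrier pow_coords by (simp add: mat_zpow_def dim int_pow_int)
  next
    case True
    define m where "m = nat (- e)"
    have e: "e = - int m" using True by (simp add: m_def)
    define X where "X = companion [^]\<^bsub>Mat\<^esub> m"
    define Y where "Y = inv\<^bsub>Mat\<^esub> X"
    have "X \<in> Units Mat" unfolding X_def by (intro Units_pow_closed companion_Units)
    then have Y: "Y \<in> carrier_mat d d" "Y * X = 1\<^sub>m d"
      using Units_inv_closed[of X] Units_l_inv[of X] by (auto simp: Y_def ring_mat_simps)
    have X: "X \<in> carrier_mat d d" using pow_carrier by (simp add: X_def)
    \<comment> \<open>\<open>X\<close> takes the coordinates of \<open>zpow e * f\<close> to those
      of \<open>f\<close>, so its left inverse \<open>Y\<close> must act as multiplication by
      \<open>zpow e\<close>.\<close>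
    have "X *\<^sub>v coords (zpow e * f) = coords f"
      unfolding X_def pow_coords mult.assoc[symmetric] zpow_mult e by simp
    then have "Y *\<^sub>v coords f = coords (zpow e * f)"
      using assoc_mult_mat_vec[OF Y(1) X coords_carrier, of "zpow e * f"] Y(2)
      by (metis coords_carrier one_mult_mat_vec)
    moreover have "mat_zpow companion e = Y"
      unfolding mat_zpow_def dim int_pow_def2 Y_def X_def m_def by (simp only: True if_True)
    ultimately show ?thesis using Y by simp
  qed
  then show "mat_zpow companion e \<in> carrier_mat d d"
    "mat_zpow companion e *\<^sub>v coords f = coords (zpow e * f)" by simp_all
qed

lemma mat_sum_coords:
  assumes "finite I"
    and "\<And>i. i \<in> I \<Longrightarrow> F i \<in> carrier_mat d d"
    and "\<And>i f. i \<in> I \<Longrightarrow> F i *\<^sub>v coords f = coords (p i * f)"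
  shows "mat_sum d F I \<in> carrier_mat d d"
    and "mat_sum d F I *\<^sub>v coords f = coords ((\<Sum>i\<in>I. p i) * f)"
proof -
  interpret ring Mat by (rule ring_mat)
  have "mat_sum d F I \<in> carrier_mat d d \<and>
      mat_sum d F I *\<^sub>v coords f = coords ((\<Sum>i\<in>I. p i) * f)"
    using assms
  proof (induction I)
    case empty
    have "coords 0 = 0\<^sub>v d" by (simp add: coords_eq_0_iff)
    then show ?case by (auto simp: mat_sum_def ring_mat_simps)
  next
    case (insert i I)
    have F: "F \<in> I \<rightarrow> carrier Mat" "F i \<in> carrier Mat"
      using insert.prems(1) by (auto simp: ring_mat_simps)
    have "mat_sum d F (insert i I) = F i + mat_sum d F I"
      using finsum_insert[OF insert.hyps F] by (simp add: mat_sum_def ring_mat_simps)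
    then show ?case
      using insert by (simp add: add_mult_distrib_mat_vec[of _ d d] coords_add distrib_right)
  qed
  then show "mat_sum d F I \<in> carrier_mat d d"
    "mat_sum d F I *\<^sub>v coords f = coords ((\<Sum>i\<in>I. p i) * f)" by simp_all
qed

end

section \<open>Cokernels\<close>

text \<open>Two surjective additive maps from one source with the same fibres: \<open>h x\<close> is
  sent to \<open>h' x\<close>, whichever preimage is chosen.\<close>

lemma iso_if_common_parametrization:
  fixes h :: "'r :: plus \<Rightarrow> 'a" and h' :: "'r \<Rightarrow> 'b"
  assumes "range h = carrier G" "range h' = carrier H"
    and "\<And>x y. h (x + y) = h x \<otimes>\<^bsub>G\<^esub> h y" "\<And>x y. h' (x + y) = h' x \<otimes>\<^bsub>H\<^esub> h' y"
    and eq: "\<And>x y. h x = h y \<longleftrightarrow> h' x = h' y"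
  shows "G \<cong> H"
proof -
  define F where "F a = h' (inv_into UNIV h a)" for a
  have F: "F (h x) = h' x" for x
    unfolding F_def using eq by (metis f_inv_into_f rangeI)
  have "F \<in> iso G H"
  proof (rule isoI)
    show "F \<in> hom G H"
      unfolding hom_def using assms(1,2)[symmetric] assms(3,4)[symmetric] by (auto simp: F)
    show "bij_betw F (carrier G) (carrier H)"
      unfolding bij_betw_def inj_on_def using assms(1,2)[symmetric] by (auto simp: F eq image_image)
  qed
  then show ?thesis by (auto simp: is_iso_def)
qed

definition coker_class :: "int mat \<Rightarrow> int vec \<Rightarrow> int vec set" where
  "coker_class M v = ((\<lambda>v. M *\<^sub>v v) ` carrier_vec (dim_col M)) #>\<^bsub>monoid_vec TYPE(int) (dim_row M)\<^esub> v"

lemma image_subgroup: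
  assumes M: "(M :: int mat) \<in> carrier_mat m n"
  shows "((\<lambda>v. M *\<^sub>v v) ` carrier_vec n) \<lhd> monoid_vec TYPE(int) m"
proof -
  interpret comm_group "monoid_vec TYPE(int) m" by (rule comm_group_vec)
  interpret n: comm_group "monoid_vec TYPE(int) n" by (rule comm_group_vec)
  interpret hom: group_hom "monoid_vec TYPE(int) n" "monoid_vec TYPE(int) m" "\<lambda>v. M *\<^sub>v v"
    using M by unfold_locales (auto simp: hom_def monoid_vec_simps mult_add_distrib_mat_vec)
  show ?thesis
    using hom.img_is_subgroup by (simp add: normal_iff_subgroup monoid_vec_simps)
qed

lemma coker_carrier:
  assumes "M \<in> carrier_mat m n"
  shows "carrier (coker M) = coker_class M ` carrier_vec m"
  using assms by (auto simp: coker_def coker_class_def carrier_FactGroup monoid_vec_simps)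

lemma coker_class_add:
  assumes M: "M \<in> carrier_mat m n" and "u \<in> carrier_vec m" "v \<in> carrier_vec m"
  shows "coker_class M (u + v) = coker_class M u \<otimes>\<^bsub>coker M\<^esub> coker_class M v"
  using normal.rcos_sum[OF image_subgroup[OF M], of u v] assms
  by (auto simp: coker_def coker_class_def monoid_vec_simps)

lemma coker_class_eq_iff:
  assumes M: "M \<in> carrier_mat m n" and uv: "u \<in> carrier_vec m" "v \<in> carrier_vec m"
  shows "coker_class M u = coker_class M v \<longleftrightarrow> (\<exists>w\<in>carrier_vec n. M *\<^sub>v w = u - v)"
proof -
  let ?H = "(\<lambda>v. M *\<^sub>v v) ` carrier_vec n"
  interpret comm_group "monoid_vec TYPE(int) m" by (rule comm_group_vec)
  interpret normal ?H "monoid_vec TYPE(int) m" by (rule image_subgroup[OF M])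
  have "coker_class M u = coker_class M v \<longleftrightarrow> u \<in> ?H #>\<^bsub>monoid_vec TYPE(int) m\<^esub> v"
    using uv M repr_independence[of u ?H v] repr_independenceD[of ?H u v] subgroup_axioms
    by (auto simp: coker_class_def monoid_vec_simps)
  also have "\<dots> \<longleftrightarrow> (\<exists>w\<in>carrier_vec n. u = M *\<^sub>v w + v)"
    by (auto simp: r_coset_def monoid_vec_simps)
  also have "\<dots> \<longleftrightarrow> (\<exists>w\<in>carrier_vec n. M *\<^sub>v w = u - v)"
  proof (rule bex_cong)
    fix w :: "int vec" assume "w \<in> carrier_vec n"
    then have "M *\<^sub>v w \<in> carrier_vec m" using M by simp
    then show "u = M *\<^sub>v w + v \<longleftrightarrow> M *\<^sub>v w = u - v"
      using uv M by (auto simp: vec_eq_iff)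
  qed simp
  finally show ?thesis .
qed

lemma coker_class_pow:
  assumes M: "M \<in> carrier_mat m n" and v: "v \<in> carrier_vec m"
  shows "coker_class M v [^]\<^bsub>coker M\<^esub> (k :: nat) = coker_class M (int k \<cdot>\<^sub>v v)"
proof -
  interpret comm_group "monoid_vec TYPE(int) m" by (rule comm_group_vec)
  have "v [^]\<^bsub>monoid_vec TYPE(int) m\<^esub> k = int k \<cdot>\<^sub>v v"
  proof (induction k)
    case 0
    then show ?case using v by (auto simp: monoid_vec_simps)
  next
    case (Suc k)
    then show ?case using v by (simp add: monoid_vec_simps add_smult_distrib_vec comm_add_vec[of v m])
  qed
  then show ?thesis
    using normal.FactGroup_pow[OF image_subgroup[OF M], of v k] M v
    by (auto simp: coker_def coker_class_def monoid_vec_simps)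
qed

lemma coker_one:
  assumes M: "M \<in> carrier_mat m n"
  shows "\<one>\<^bsub>coker M\<^esub> = coker_class M (0\<^sub>v m)"
proof -
  interpret comm_group "monoid_vec TYPE(int) m" by (rule comm_group_vec)
  interpret normal "(\<lambda>v. M *\<^sub>v v) ` carrier_vec n" "monoid_vec TYPE(int) m"
    by (rule image_subgroup[OF M])
  show ?thesis
    using M coset_mult_one[OF subset] by (simp add: coker_def coker_class_def monoid_vec_simps)
qed

text \<open>A power of a class is the class of a multiple, so torsion becomes solvability of a
  linear system.\<close>

lemma torsion_coker_carrier:
  assumes M: "M \<in> carrier_mat m n"
  shows "carrier (torsion_subgroup (coker M)) =
    coker_class M ` {v \<in> carrier_vec m. \<exists>k>0. \<exists>w\<in>carrier_vec n. M *\<^sub>v w = int k \<cdot>\<^sub>v v}"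
proof -
  have "coker_class M v [^]\<^bsub>coker M\<^esub> k = \<one>\<^bsub>coker M\<^esub> \<longleftrightarrow>
      (\<exists>w\<in>carrier_vec n. M *\<^sub>v w = int k \<cdot>\<^sub>v v)" if "v \<in> carrier_vec m" for v and k :: nat
    using that by (simp add: coker_class_pow[OF M] coker_one[OF M] coker_class_eq_iff[OF M])
  then show ?thesis
    unfolding torsion_subgroup_def coker_carrier[OF M] by (auto intro!: imageI)
qed

section \<open>The cone over a circulant graph\<close>

lemma laplacian_carrier:
  assumes "pverts G = {0..<N}"
  shows "laplacian G \<in> carrier_mat N N"
  using assms by (auto simp: laplacian_def degree_mat_def adjacency_mat_def)

lemma laplacian_mult_vec:
  fixes G :: "nat pair_pre_digraph"
  assumes V: "pverts G = {0..<N}" and "parcs G \<subseteq> {0..<N} \<times> {0..<N}"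
    and "i < N" "v \<in> carrier_vec N"
  shows "(laplacian G *\<^sub>v v) $ i = (\<Sum>j | (i, j) \<in> parcs G. v $ i - v $ j)"
proof -
  let ?N = "{j. (i, j) \<in> parcs G}"
  have N: "?N \<subseteq> {0..<N}" using assms(2) by auto
  \<comment> \<open>The increasing enumeration of \<open>{0..<N}\<close> is the identity, so
    vertices are their own matrix indices.\<close>
  have vertex: "vertex G j = j" if "j < N" for j
    using that by (simp add: vertex_def V)
  have "out_arcs (with_proj G) i = Pair i ` ?N"
    by (auto simp: out_arcs_def image_iff)
  then have deg: "out_degree (with_proj G) i = card ?N"
    by (simp add: out_degree_def card_image inj_on_def)
  have "(laplacian G *\<^sub>v v) $ i = (\<Sum>j\<in>{0..<N}. laplacian G $$ (i, j) * v $ j)"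
    using assms laplacian_carrier[OF V] by (auto simp: scalar_prod_def)
  also have "\<dots> = (\<Sum>j\<in>{0..<N}. (if i = j then int (card ?N) * v $ i else 0) - (if j \<in> ?N then v $ j else 0))"
    using assms(3) by (intro sum.cong)
      (auto simp: laplacian_def degree_mat_def adjacency_mat_def V vertex deg algebra_simps)
  also have "\<dots> = int (card ?N) * v $ i - (\<Sum>j\<in>{0..<N} \<inter> ?N. v $ j)"
    using assms(3) by (simp add: sum_subtractf sum.inter_restrict)
  also have "{0..<N} \<inter> ?N = ?N" using N by auto
  finally show ?thesis by (simp add: sum_subtractf)
qed

locale circulant_shifts =
  fixes n :: nat and T :: "nat set"
  assumes n_pos: "0 < n" and T_subset: "T \<subseteq> {1..<n}"
begin

lemma finite_T [simp]: "finite T"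
  using T_subset finite_subset by blast

text \<open>Signed steps from a rim vertex to its rim neighbours. The step \<open>n\<close> occurs
  with one sign only, as \<open>n\<close> and \<open>- n\<close> agree modulo
  \<open>2 * n\<close>.\<close>

definition shifts :: "int set" where
  "shifts = int ` T \<union> uminus ` int ` T \<union> {int n}"

lemma shifts_subset: "shifts \<subseteq> {- int n<..int n}"
  using T_subset n_pos by (auto simp: shifts_def)

lemma finite_shifts [simp]: "finite shifts"
  by (simp add: shifts_def)

lemma sum_shifts: "sum h shifts = (\<Sum>t\<in>T. h (int t) + h (- int t)) + h (int n)"
proof -
  have "int ` T \<inter> uminus ` int ` T = {}" "int n \<notin> int ` T \<union> uminus ` int ` T"
    using T_subset by force+
  then show ?thesis
    by (simp add: shifts_def sum.union_disjoint sum.reindex inj_on_def sum.distrib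
        add.commute image_image)
qed

lemma card_shifts: "card shifts = 2 * card T + 1"
  using sum_shifts[of "\<lambda>_. 1 :: nat"] by (simp add: mult.commute)

text \<open>For \<open>i < 2 * n\<close>, the coefficient at exponent \<open>i\<close> after
  reduction modulo \<open>zpow (2 * int n) - 1\<close>.\<close>

definition residue_sum :: "nat \<Rightarrow> laurent_poly \<Rightarrow> int" where
  "residue_sum i = pairing (\<lambda>e. of_bool (e mod (2 * int n) = int i))"

text \<open>The polynomial \<open>E\<close> of the overview. The constant
  \<open>2 * card T + 2\<close> is the degree of a rim vertex in the cone: one edge per shift and
  one to the apex.\<close>

definition lattice_poly :: laurent_poly where
  "lattice_poly = of_nat (2 * card T + 2) - (\<Sum>t\<in>shifts. zpow t)"

text \<open>The shift is subtracted because multiplication by \<open>zpow t\<close> brings the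
  coefficient at \<open>i - t\<close> to \<open>i\<close>.\<close>

definition shifted :: "nat \<Rightarrow> int \<Rightarrow> nat" where
  "shifted i t = nat ((int i - t) mod (2 * int n))"

lemma shifted_less: "shifted i t < 2 * n"
  using n_pos pos_mod_bound[of "2 * int n" "int i - t"] by (simp add: shifted_def nat_less_iff)

lemma int_shifted: "int (shifted i t) = (int i - t) mod (2 * int n)"
  using n_pos by (simp add: shifted_def)

lemma shifted_eq_iff:
  assumes "j < 2 * n"
  shows "shifted i t = j \<longleftrightarrow> [int i = int j + t] (mod (2 * int n))"
proof -
  have "shifted i t = j \<longleftrightarrow> (int i - t) mod (2 * int n) = int j mod (2 * int n)"
    using assms int_shifted[of i t] by auto
  also have "\<dots> \<longleftrightarrow> [int i = int j + t] (mod (2 * int n))"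
    unfolding cong_def[symmetric] by (simp add: cong_iff_dvd_diff algebra_simps)
  finally show ?thesis .
qed

text \<open>All shifts lie in a half-open interval of length \<open>2 * n\<close>, so distinct ones
  are incongruent. A rim vertex thus has as many rim neighbours as there are shifts.\<close>

lemma inj_on_shifted: "inj_on (shifted i) shifts"
proof (rule inj_onI)
  fix t t' assume t: "t \<in> shifts" "t' \<in> shifts" "shifted i t = shifted i t'"
  then have "(int i - t) mod (2 * int n) = (int i - t') mod (2 * int n)"
    using int_shifted by metis
  then have "2 * int n dvd t' - t" by (simp add: mod_eq_dvd_iff)
  moreover have "\<bar>t' - t\<bar> < 2 * int n"
  proof -
    have "t \<in> {- int n<..int n}" "t' \<in> {- int n<..int n}" using t(1,2) shifts_subset by auto
    then show ?thesis by auto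
  qed
  ultimately show "t = t'"
    using zdvd_imp_le[of "2 * int n" "\<bar>t' - t\<bar>"] by auto
qed

section \<open>Reduction of exponents modulo 2n\<close>

lemma residue_sum_diff: "residue_sum i (f - g) = residue_sum i f - residue_sum i g"
  by (simp add: residue_sum_def pairing_diff)

lemma residue_sum_shift:
  assumes "i < 2 * n"
  shows "residue_sum i (zpow t * f) = residue_sum (shifted i t) f"
proof -
  have "(t + e) mod (2 * int n) = int i \<longleftrightarrow> e mod (2 * int n) = int (shifted i t)" for e
  proof -
    have "(t + e) mod (2 * int n) = int i \<longleftrightarrow> [t + e = int i] (mod (2 * int n))"
      using assms by (simp add: cong_def)
    also have "\<dots> \<longleftrightarrow> [e = int i - t] (mod (2 * int n))"
      by (simp add: cong_iff_dvd_diff algebra_simps)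
    finally show ?thesis by (simp add: int_shifted cong_def)
  qed
  then show ?thesis by (simp add: residue_sum_def pairing_shift)
qed

lemma pairing_of_nat_mult: "pairing h (of_nat c * f) = int c * pairing h f"
  by (induction c) (simp_all add: distrib_right pairing_add)

lemma residue_sum_lattice_poly:
  assumes "i < 2 * n"
  shows "residue_sum i (lattice_poly * f) =
    int (2 * card T + 2) * residue_sum i f - (\<Sum>t\<in>shifts. residue_sum (shifted i t) f)"
proof -
  have "residue_sum i (lattice_poly * f) =
      int (2 * card T + 2) * residue_sum i f - (\<Sum>t\<in>shifts. residue_sum i (zpow t * f))"
    unfolding lattice_poly_def left_diff_distrib residue_sum_def
    by (simp only: pairing_diff pairing_of_nat_mult sum_distrib_right pairing_sum)
  then show ?thesis using assms by (simp add: residue_sum_shift)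
qed

text \<open>Pairing with the constant 1 evaluates at 1, where \<open>lattice_poly\<close> takes the
  value \<open>(2 * card T + 2) - (2 * card T + 1)\<close>.\<close>

lemma pairing_1_lattice_poly: "pairing (\<lambda>_. 1) (lattice_poly * f) = pairing (\<lambda>_. 1) f"
  unfolding lattice_poly_def left_diff_distrib sum_distrib_right
    pairing_diff pairing_of_nat_mult pairing_sum pairing_shift
  by (simp add: card_shifts algebra_simps)

lemma sum_residue_sum: "(\<Sum>i<2 * n. residue_sum i f) = pairing (\<lambda>_. 1) f"
proof (induction f rule: laurent_induct)
  case (zpow e)
  have "e mod (2 * int n) = int i \<longleftrightarrow> i = nat (e mod (2 * int n))" for i
    using n_pos by auto
  moreover have "nat (e mod (2 * int n)) < 2 * n"
    using n_pos by (simp add: nat_less_iff)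
  ultimately show ?case by (simp add: residue_sum_def)
next
  case (diff f g)
  then show ?case by (simp add: residue_sum_diff pairing_diff sum_subtractf)
qed

definition reduced :: "(nat \<Rightarrow> int) \<Rightarrow> laurent_poly" where
  "reduced c = (\<Sum>j<2 * n. frag_cmul (c j) (zpow (int j)))"

lemma residue_sum_reduced: "residue_sum i (reduced c) = c i" if "i < 2 * n"
proof -
  have "residue_sum i (reduced c) = (\<Sum>j<2 * n. if j = i then c j else 0)"
    unfolding reduced_def residue_sum_def pairing_sum
    by (intro sum.cong) (auto simp: pairing_frag_cmul)
  then show ?thesis using that by simp
qed

text \<open>For \<open>q\<close> nonnegative this is the geometric sum; for negative
  \<open>q\<close> the unit \<open>- zpow (m * q)\<close> leads back to that case.\<close>

lemma zpow_diff_1_dvd: "zpow m - 1 dvd zpow (m * q) - 1"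
proof -
  have pos: "zpow m - 1 dvd zpow (m * int q) - 1" for q
    using power_diff_1_eq[of "zpow m" q] by (simp add: zpow_power mult.commute)
  show ?thesis
  proof (cases q rule: int_cases2)
    case (nonpos r)
    have "zpow (m * q) - 1 = - zpow (m * q) * (zpow (m * int r) - 1)"
      by (simp add: nonpos right_diff_distrib zpow_mult)
    then show ?thesis using pos[of r] by (metis dvd_mult)
  qed (use pos in simp)
qed

lemma dvd_diff_reduced:
  "zpow (2 * int n) - 1 dvd f - reduced (\<lambda>i. residue_sum i f)"
proof (induction f rule: laurent_induct)
  case (zpow e)
  define r where "r = nat (e mod (2 * int n))"
  have r: "int r = e mod (2 * int n)" "r < 2 * n"
    using n_pos by (auto simp: r_def nat_less_iff)
  have "reduced (\<lambda>i. residue_sum i (zpow e)) = (\<Sum>j<2 * n. if j = r then zpow (int r) else 0)"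
    unfolding reduced_def by (intro sum.cong) (auto simp: residue_sum_def simp flip: r(1))
  also have "\<dots> = zpow (int r)" using r by simp
  finally have "zpow e - reduced (\<lambda>i. residue_sum i (zpow e)) =
      zpow (int r) * (zpow (2 * int n * (e div (2 * int n))) - 1)"
    by (simp add: right_diff_distrib zpow_mult r)
  then show ?case by (simp add: zpow_diff_1_dvd)
next
  case (diff f g)
  have "reduced (\<lambda>i. residue_sum i (f - g)) =
      reduced (\<lambda>i. residue_sum i f) - reduced (\<lambda>i. residue_sum i g)"
    by (simp add: reduced_def residue_sum_diff frag_cmul_diff_distrib sum_subtractf)
  then have "(f - g) - reduced (\<lambda>i. residue_sum i (f - g)) =
      (f - reduced (\<lambda>i. residue_sum i f)) - (g - reduced (\<lambda>i. residue_sum i g))"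
    by simp
  then show ?case using dvd_diff[OF diff] by metis
qed

lemma residue_sums_eq_0_iff: "(\<forall>i<2 * n. residue_sum i f = 0) \<longleftrightarrow> zpow (2 * int n) - 1 dvd f"
proof
  assume "\<forall>i<2 * n. residue_sum i f = 0"
  then have "reduced (\<lambda>i. residue_sum i f) = 0" by (simp add: reduced_def)
  then show "zpow (2 * int n) - 1 dvd f" using dvd_diff_reduced[of f] by simp
next
  assume "zpow (2 * int n) - 1 dvd f"
  then obtain q where f: "f = (zpow (2 * int n) - 1) * q" by (rule dvdE)
  have "shifted i (2 * int n) = i" if "i < 2 * n" for i
    using that by (simp add: shifted_def)
  then show "\<forall>i<2 * n. residue_sum i f = 0"
    unfolding f left_diff_distrib by (simp add: residue_sum_diff residue_sum_shift)
qed

text \<open>The apex has index \<open>2 * n\<close>. Its entry is minus the value of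
  \<open>f\<close> at 1, which makes the entries sum to 0.\<close>

definition vertex_vec :: "laurent_poly \<Rightarrow> int vec" where
  "vertex_vec f = vec (2 * n + 1) (\<lambda>i. if i < 2 * n then residue_sum i f else - pairing (\<lambda>_. 1) f)"

lemma vertex_vec_carrier [simp]: "vertex_vec f \<in> carrier_vec (2 * n + 1)"
  by (simp add: vertex_vec_def)

lemma vertex_vec_diff: "vertex_vec (f - g) = vertex_vec f - vertex_vec g"
  by (rule eq_vecI) (auto simp: vertex_vec_def residue_sum_diff pairing_diff)

lemma vertex_vec_add: "vertex_vec (f + g) = vertex_vec f + vertex_vec g"
  by (rule eq_vecI) (auto simp: vertex_vec_def residue_sum_def pairing_add)

lemma sum_vertex_vec: "(\<Sum>i<2 * n + 1. vertex_vec f $ i) = 0"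
  by (simp add: vertex_vec_def sum_residue_sum)

lemma vertex_vec_eqI:
  assumes "v \<in> carrier_vec (2 * n + 1)" "\<And>i. i < 2 * n \<Longrightarrow> v $ i = residue_sum i f"
    and "(\<Sum>i<2 * n + 1. v $ i) = 0"
  shows "vertex_vec f = v"
proof -
  have "(\<Sum>i<2 * n. residue_sum i f) + v $ (2 * n) = 0"
    using assms(2,3) by simp
  then have "v $ (2 * n) = - pairing (\<lambda>_. 1) f"
    by (simp add: sum_residue_sum)
  then show ?thesis
    using assms(1,2) by (intro eq_vecI) (auto simp: vertex_vec_def less_Suc_eq)
qed

lemma vertex_vec_eq_iff: "vertex_vec f = vertex_vec g \<longleftrightarrow> zpow (2 * int n) - 1 dvd f - g"
proof -
  have "vertex_vec f = vertex_vec g \<longleftrightarrow> (\<forall>i<2 * n. residue_sum i f = residue_sum i g)"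
  proof
    assume "vertex_vec f = vertex_vec g"
    then have "vertex_vec f $ i = vertex_vec g $ i" for i by simp
    moreover have "vertex_vec h $ i = residue_sum i h" if "i < 2 * n" for h i
      using that by (simp add: vertex_vec_def)
    ultimately show "\<forall>i<2 * n. residue_sum i f = residue_sum i g" by metis
  next
    assume *: "\<forall>i<2 * n. residue_sum i f = residue_sum i g"
    then show "vertex_vec f = vertex_vec g"
      by (intro vertex_vec_eqI sum_vertex_vec) (simp_all add: vertex_vec_def)
  qed
  then show ?thesis
    using residue_sums_eq_0_iff[of "f - g"] by (simp add: residue_sum_diff)
qed

section \<open>The Laplacian of the cone as multiplication by a polynomial\<close>

definition Cone :: "nat pair_pre_digraph" where
  "Cone = cone_graph (2 * n) (circulant_graph (2 * n) (T \<union> {n}))"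

lemma pverts_Cone: "pverts Cone = {0..<2 * n + 1}"
  by (auto simp: Cone_def cone_graph_def circulant_graph_def)

lemma parcs_Cone: "parcs Cone \<subseteq> {0..<2 * n + 1} \<times> {0..<2 * n + 1}"
  by (auto simp: Cone_def cone_graph_def circulant_graph_def)

lemma neighbours_apex: "{j. (2 * n, j) \<in> parcs Cone} = {..<2 * n}"
  by (auto simp: Cone_def cone_graph_def circulant_graph_def)

lemma neighbours_rim:
  assumes "i < 2 * n"
  shows "{j. (i, j) \<in> parcs Cone} = insert (2 * n) (shifted i ` shifts)"
proof -
  have nat_cong: "[a = b] (mod 2 * n) \<longleftrightarrow> [int a = int b] (mod 2 * int n)" for a b
    using cong_int_iff[of a b "2 * n"] by simp
  \<comment> \<open>\<open>n\<close> is its own negative modulo \<open>2 * n\<close>, so a single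
    shift accounts for both directions of the diametral edge.\<close>
  have n: "[int i = int j + int n] (mod 2 * int n) \<longleftrightarrow> [int j = int i + int n] (mod 2 * int n)" for j
  proof -
    have "[int i = int j + int n] (mod 2 * int n) \<longleftrightarrow> [int i + int n = int j + int n + int n] (mod 2 * int n)"
      by (simp only: cong_add_rcancel)
    also have "int j + int n + int n = int j + 2 * int n" by simp
    also have "[int i + int n = int j + 2 * int n] (mod 2 * int n) \<longleftrightarrow> [int i + int n = int j] (mod 2 * int n)"
      by (simp add: cong_def)
    finally show ?thesis by (simp add: cong_sym_eq)
  qed
  have neg: "[int i = int j + - int t] (mod 2 * int n) \<longleftrightarrow> [int j = int i + int t] (mod 2 * int n)" for j t
    by (subst cong_sym_eq) (simp add: cong_iff_dvd_diff algebra_simps)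
  let ?S = "\<lambda>j. \<exists>t\<in>shifts. [int i = int j + t] (mod 2 * int n)"
  have "(\<exists>t\<in>T \<union> {n}. [j = i + t] (mod 2 * n) \<or> [i = j + t] (mod 2 * n)) \<longleftrightarrow>
      ?S j" for j
  proof -
    have "?S j \<longleftrightarrow> (\<exists>t\<in>T. [int i = int j + int t] (mod 2 * int n)) \<or>
        (\<exists>t\<in>T. [int i = int j + - int t] (mod 2 * int n)) \<or> [int i = int j + int n] (mod 2 * int n)"
      unfolding shifts_def by blast
    then show ?thesis
      unfolding nat_cong of_nat_add neg using n[of j] by blast
  qed
  moreover have "?S j \<longleftrightarrow> j \<in> shifted i ` shifts" if "j < 2 * n" for j
    unfolding image_iff using shifted_eq_iff[OF that, of i] by (metis (no_types))
  ultimately have "(\<exists>t\<in>T \<union> {n}. [j = i + t] (mod 2 * n) \<or> [i = j + t] (mod 2 * n)) \<longleftrightarrow>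
      j \<in> shifted i ` shifts" if "j < 2 * n" for j using that by blast
  moreover have "shifted i ` shifts \<subseteq> {..<2 * n}" using shifted_less by auto
  ultimately show ?thesis
    using assms unfolding Cone_def cone_graph_def circulant_graph_def by auto
qed

text \<open>The Laplacian only sees differences, so values may be taken relative to the apex. On the
  rim the edge to the apex completes the constant of \<open>lattice_poly\<close>; at the apex the
  row gives minus the value of \<open>f\<close> at 1, and \<open>lattice_poly\<close> is 1
  there.\<close>

lemma laplacian_Cone:
  assumes v: "v \<in> carrier_vec (2 * n + 1)"
    and f: "\<And>j. j < 2 * n \<Longrightarrow> v $ j - v $ (2 * n) = residue_sum j f"
  shows "laplacian Cone *\<^sub>v v = vertex_vec (lattice_poly * f)"
proof (rule eq_vecI)
  fix i assume "i < dim_vec (vertex_vec (lattice_poly * f))"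
  then have "i < 2 * n + 1" by (simp add: vertex_vec_def)
  note L = laplacian_mult_vec[OF pverts_Cone parcs_Cone this v]
  show "(laplacian Cone *\<^sub>v v) $ i = vertex_vec (lattice_poly * f) $ i"
  proof (cases "i < 2 * n")
    case True
    have diff: "v $ i - v $ j = residue_sum i f - residue_sum j f" if "j < 2 * n" for j
      using f[OF that] f[OF True] by simp
    have "2 * n \<notin> shifted i ` shifts" using shifted_less by (metis imageE less_irrefl)
    then have "(laplacian Cone *\<^sub>v v) $ i =
        (v $ i - v $ (2 * n)) + (\<Sum>j\<in>shifted i ` shifts. v $ i - v $ j)"
      unfolding L neighbours_rim[OF True] by (simp add: sum.insert)
    also have "\<dots> = residue_sum i f + (\<Sum>t\<in>shifts. residue_sum i f - residue_sum (shifted i t) f)"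
      using f[OF True] by (simp add: sum.reindex inj_on_shifted diff shifted_less)
    also have "\<dots> = residue_sum i (lattice_poly * f)"
      unfolding residue_sum_lattice_poly[OF True]
      by (simp add: sum_subtractf card_shifts algebra_simps)
    finally show ?thesis using True by (simp add: vertex_vec_def)
  next
    case False
    then have i: "i = 2 * n" using \<open>i < 2 * n + 1\<close> by simp
    have "(laplacian Cone *\<^sub>v v) $ i = (\<Sum>j<2 * n. - residue_sum j f)"
      unfolding L unfolding i neighbours_apex by (intro sum.cong) (auto simp flip: f)
    also have "\<dots> = - pairing (\<lambda>_. 1) (lattice_poly * f)"
      by (simp add: sum_negf sum_residue_sum pairing_1_lattice_poly)
    finally show ?thesis using i by (simp add: vertex_vec_def)
  qed
qed (use laplacian_carrier[OF pverts_Cone] in \<open>simp add: vertex_vec_def\<close>)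

text \<open>Every family of differences to the apex consists of the residue sums of a
  \<open>reduced\<close> polynomial, and every polynomial arises from a vector with apex value
  0.\<close>

lemma image_laplacian_Cone:
  "(\<lambda>v. laplacian Cone *\<^sub>v v) ` carrier_vec (2 * n + 1) = range (\<lambda>f. vertex_vec (lattice_poly * f))"
proof (intro equalityI subsetI)
  fix u assume "u \<in> (\<lambda>v. laplacian Cone *\<^sub>v v) ` carrier_vec (2 * n + 1)"
  then obtain v where v: "v \<in> carrier_vec (2 * n + 1)" "u = laplacian Cone *\<^sub>v v" by auto
  have "u = vertex_vec (lattice_poly * reduced (\<lambda>j. v $ j - v $ (2 * n)))"
    unfolding v(2) by (rule laplacian_Cone[OF v(1)]) (simp add: residue_sum_reduced)
  then show "u \<in> range (\<lambda>f. vertex_vec (lattice_poly * f))" by blast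
next
  fix u assume "u \<in> range (\<lambda>f. vertex_vec (lattice_poly * f))"
  then obtain f where u: "u = vertex_vec (lattice_poly * f)" by auto
  let ?v = "vec (2 * n + 1) (\<lambda>i. if i < 2 * n then residue_sum i f else 0)"
  have "laplacian Cone *\<^sub>v ?v = u" unfolding u by (rule laplacian_Cone) auto
  moreover have "?v \<in> carrier_vec (2 * n + 1)" by simp
  ultimately show "u \<in> (\<lambda>v. laplacian Cone *\<^sub>v v) ` carrier_vec (2 * n + 1)" by blast
qed

text \<open>Strict diagonal dominance: compare both sides at an index where \<open>\<bar>residue_sum i f\<bar>\<close> is
  maximal.\<close>

lemma lattice_poly_injective:
  assumes "\<And>i. i < 2 * n \<Longrightarrow> residue_sum i (lattice_poly * f) = 0" and "i < 2 * n"
  shows "residue_sum i f = 0"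
proof -
  let ?r = "\<lambda>i. \<bar>residue_sum i f\<bar>"
  define M where "M = Max (?r ` {..<2 * n})"
  have "M \<in> ?r ` {..<2 * n}" unfolding M_def using n_pos by (intro Max_in) (auto simp: lessThan_empty_iff)
  then obtain l where l: "l < 2 * n" "M = ?r l" by auto
  have le: "?r j \<le> M" if "j < 2 * n" for j unfolding M_def using that by (intro Max_ge) auto
  have "int (2 * card T + 2) * residue_sum l f = (\<Sum>t\<in>shifts. residue_sum (shifted l t) f)"
    using assms(1)[OF l(1)] residue_sum_lattice_poly[OF l(1)] by simp
  then have "int (2 * card T + 2) * M = \<bar>\<Sum>t\<in>shifts. residue_sum (shifted l t) f\<bar>"
    by (metis abs_mult abs_of_nat l(2))
  also have "\<dots> \<le> (\<Sum>t\<in>shifts. ?r (shifted l t))" by (rule sum_abs)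
  also have "\<dots> \<le> (\<Sum>t\<in>shifts. M)" by (intro sum_mono le shifted_less)
  also have "\<dots> = int (2 * card T + 1) * M" by (simp add: card_shifts)
  \<comment> \<open>The edge to the apex makes the coefficient on the left exceed the number of
    shifts by one.\<close>
  finally have "M \<le> 0" by (simp add: algebra_simps)
  then show ?thesis using le[OF assms(2)] by simp
qed

text \<open>The matrix of multiplication by \<open>lattice_poly\<close> on residues is the reduced Laplacian;
  multiplying by its adjugate shows that its determinant annihilates the cokernel.\<close>

lemma residues_torsion:
  "\<exists>c>0. \<exists>g. \<forall>i<2 * n. residue_sum i (lattice_poly * g) = int c * residue_sum i f"
proof -
  let ?N = "2 * n"
  define B where "B = mat ?N ?N (\<lambda>(i, j). residue_sum i (lattice_poly * zpow (int j)))"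
  have B: "B \<in> carrier_mat ?N ?N" by (simp add: B_def)
  have B_mult: "(B *\<^sub>v u) $ i = residue_sum i (lattice_poly * reduced (($) u))"
    if "u \<in> carrier_vec ?N" "i < ?N" for u i
  proof -
    have "residue_sum i (lattice_poly * reduced (($) u)) =
        (\<Sum>j<?N. residue_sum i (lattice_poly * zpow (int j)) * u $ j)"
      unfolding reduced_def residue_sum_def
      by (simp add: sum_distrib_left mult_frag_cmul pairing_sum pairing_frag_cmul mult.commute)
    then show ?thesis
      using that by (simp add: B_def scalar_prod_def lessThan_atLeast0)
  qed
  have "det B \<noteq> 0"
  proof
    assume "det B = 0"
    then obtain u where u: "u \<in> carrier_vec ?N" "u \<noteq> 0\<^sub>v ?N" "B *\<^sub>v u = 0\<^sub>v ?N"
      using det_0_iff_vec_prod_zero[OF B] by blast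
    have "residue_sum i (lattice_poly * reduced (($) u)) = 0" if "i < ?N" for i
      using B_mult[OF u(1) that] u(3) that by simp
    then have "residue_sum i (reduced (($) u)) = 0" if "i < ?N" for i
      using lattice_poly_injective that by blast
    then have "u $ i = 0" if "i < ?N" for i using residue_sum_reduced that by metis
    then have "u = 0\<^sub>v ?N" using u(1) by (intro eq_vecI) auto
    with u(2) show False by contradiction
  qed
  define x where "x = vec ?N (\<lambda>i. residue_sum i f)"
  have x: "x \<in> carrier_vec ?N" by (simp add: x_def)
  \<comment> \<open>The sign turns the multiplier \<open>det B\<close> into its absolute value, as a
    positive natural number is wanted.\<close>
  define u where "u = adj_mat B *\<^sub>v (sgn (det B) \<cdot>\<^sub>v x)"
  have u: "u \<in> carrier_vec ?N" using adj_mat(1)[OF B] x by (simp add: u_def)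
  have "B *\<^sub>v u = (B * adj_mat B) *\<^sub>v (sgn (det B) \<cdot>\<^sub>v x)"
    using assoc_mult_mat_vec[OF B adj_mat(1)[OF B], of "sgn (det B) \<cdot>\<^sub>v x"] x by (simp add: u_def)
  also have "\<dots> = det B \<cdot>\<^sub>v (sgn (det B) \<cdot>\<^sub>v x)"
    unfolding adj_mat(2)[OF B] using x by (intro eq_vecI) auto
  finally have "(B *\<^sub>v u) $ i = \<bar>det B\<bar> * residue_sum i f" if "i < ?N" for i
    using that x by (simp add: x_def abs_sgn mult.assoc)
  then have "\<forall>i<?N. residue_sum i (lattice_poly * reduced (($) u)) = int (nat \<bar>det B\<bar>) * residue_sum i f"
    using B_mult[OF u] by simp
  then show ?thesis using \<open>det B \<noteq> 0\<close> by (intro exI[of _ "nat \<bar>det B\<bar>"]) auto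
qed

abbreviation "jac_class f \<equiv> coker_class (laplacian Cone) (vertex_vec f)"

text \<open>The torsion classes are those of the vectors of sum zero. The image of the Laplacian has
  sum zero, so a vector with a positive multiple in it has sum zero too; conversely,
  \<open>residues_torsion\<close> supplies such a multiple.\<close>

lemma range_jac_class: "range jac_class = carrier (Jac Cone)"
proof -
  let ?L = "laplacian Cone" and ?V = "carrier_vec (2 * n + 1) :: int vec set"
  note L = laplacian_carrier[OF pverts_Cone]
  have "{v \<in> ?V. \<exists>c>0. \<exists>w\<in>?V. ?L *\<^sub>v w = int c \<cdot>\<^sub>v v} = range vertex_vec"
  proof (intro equalityI subsetI)
    fix v assume "v \<in> {v \<in> ?V. \<exists>c>0. \<exists>w\<in>?V. ?L *\<^sub>v w = int c \<cdot>\<^sub>v v}"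
    then obtain c w where v: "v \<in> ?V" and c: "c > 0" "w \<in> ?V" "?L *\<^sub>v w = int c \<cdot>\<^sub>v v" by auto
    have "int c \<cdot>\<^sub>v v \<in> range (\<lambda>f. vertex_vec (lattice_poly * f))"
      unfolding image_laplacian_Cone[symmetric] using c(3)[symmetric] c(2) by (rule image_eqI)
    then obtain g where "int c \<cdot>\<^sub>v v = vertex_vec g" by auto
    then have "(\<Sum>i<2 * n + 1. (int c \<cdot>\<^sub>v v) $ i) = 0" by (simp only: sum_vertex_vec)
    moreover have "(\<Sum>i<2 * n + 1. (int c \<cdot>\<^sub>v v) $ i) = int c * (\<Sum>i<2 * n + 1. v $ i)"
      unfolding sum_distrib_left using v by (intro sum.cong) auto
    ultimately have "(\<Sum>i<2 * n + 1. v $ i) = 0" using c(1) by (metis mult_eq_0_iff of_nat_eq_0_iff less_irrefl)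
    then have "vertex_vec (reduced (($) v)) = v"
      using v by (intro vertex_vec_eqI) (simp_all add: residue_sum_reduced)
    then show "v \<in> range vertex_vec" by (metis rangeI)
  next
    fix v assume "v \<in> range vertex_vec"
    then obtain f where v: "v = vertex_vec f" by auto
    obtain c g where c: "c > 0"
      and g: "\<forall>i<2 * n. residue_sum i (lattice_poly * g) = int c * residue_sum i f"
      using residues_torsion[of f] by blast
    have "vertex_vec (lattice_poly * g) = vertex_vec (of_nat c * f)"
    proof (rule vertex_vec_eqI[OF vertex_vec_carrier _ sum_vertex_vec])
      fix i assume "i < 2 * n"
      then show "vertex_vec (of_nat c * f) $ i = residue_sum i (lattice_poly * g)"
        using g by (simp add: vertex_vec_def) (simp add: residue_sum_def pairing_of_nat_mult)
    qed
    also have "\<dots> = int c \<cdot>\<^sub>v v"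
      unfolding v by (rule eq_vecI) (auto simp: vertex_vec_def residue_sum_def pairing_of_nat_mult)
    finally have "int c \<cdot>\<^sub>v v \<in> (\<lambda>v. ?L *\<^sub>v v) ` ?V" unfolding image_laplacian_Cone by (metis rangeI)
    then obtain w where "w \<in> ?V" "?L *\<^sub>v w = int c \<cdot>\<^sub>v v" by auto
    moreover have "v \<in> ?V" unfolding v by (rule vertex_vec_carrier)
    ultimately show "v \<in> {v \<in> ?V. \<exists>c>0. \<exists>w\<in>?V. ?L *\<^sub>v w = int c \<cdot>\<^sub>v v}"
      using c by blast
  qed
  then show ?thesis by (simp only: Jac_def torsion_coker_carrier[OF L] image_image)
qed

lemma jac_class_add: "jac_class (f + g) = jac_class f \<otimes>\<^bsub>Jac Cone\<^esub> jac_class g"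
  using coker_class_add[OF laplacian_carrier[OF pverts_Cone] vertex_vec_carrier vertex_vec_carrier]
  by (simp add: Jac_def torsion_subgroup_def vertex_vec_add)

text \<open>The image of the Laplacian contributes the multiples of \<open>lattice_poly\<close>, the
  kernel of \<open>vertex_vec\<close> those of \<open>zpow (2 * int n) - 1\<close>.\<close>

lemma jac_class_eq_iff:
  "jac_class f = jac_class g \<longleftrightarrow> (\<exists>q. zpow (2 * int n) - 1 dvd (f - g) - lattice_poly * q)"
proof -
  have "jac_class f = jac_class g \<longleftrightarrow>
      vertex_vec (f - g) \<in> (\<lambda>v. laplacian Cone *\<^sub>v v) ` carrier_vec (2 * n + 1)"
    unfolding coker_class_eq_iff[OF laplacian_carrier[OF pverts_Cone] vertex_vec_carrier vertex_vec_carrier]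
    unfolding vertex_vec_diff by (auto simp: image_iff) metis+
  then show ?thesis by (simp only: image_laplacian_Cone image_iff bex_UNIV vertex_vec_eq_iff)
qed

end

section \<open>Comparing the two quotients\<close>

text \<open>Each side says that \<open>x\<close> lies in the ideal generated by \<open>E\<close> and
  one of \<open>P\<close>, \<open>R\<close>. These ideals agree, since \<open>P\<close> and
  \<open>R\<close> differ by a multiple of \<open>E\<close>.\<close>

lemma ex_dvd_modulo_cong:
  fixes P R E U :: "'a :: comm_ring_1"
  assumes "P - R = E * U"
  shows "(\<exists>q. P dvd x - E * q) \<longleftrightarrow> (\<exists>q. R dvd x - E * q)"
proof -
  have imp: "\<exists>q. R dvd x - E * q" if eq: "P - R = E * U" and dvd: "P dvd x - E * q" for P R U q
  proof -
    obtain y where "x - E * q = P * y" using dvd by (rule dvdE)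
    moreover have "P = R + E * U" using eq by (simp add: algebra_simps)
    ultimately have "x - E * (q + U * y) = R * y" by (simp add: algebra_simps)
    then show ?thesis by (metis dvd_triv_left)
  qed
  have "R - P = E * (- U)" using assms by (simp add: algebra_simps)
  then show ?thesis using imp[OF assms] imp[of R P "- U"] by blast
qed

lemma zpow_mult_dvd_iff: "zpow m * P dvd x \<longleftrightarrow> P dvd x"
proof
  assume "P dvd x"
  then have "zpow m * P dvd zpow m * (zpow (- m) * x)" by (intro mult_dvd_mono) auto
  then show "zpow m * P dvd x" by (simp add: zpow_mult flip: mult.assoc)
qed (auto intro: dvd_mult_right)

lemma smult_one_mult_vec: "(c \<cdot>\<^sub>m 1\<^sub>m m) *\<^sub>v v = c \<cdot>\<^sub>v v" if "v \<in> carrier_vec m" for c :: int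
  using that by (intro eq_vecI) auto

context bimonic
begin

lemma coords_of_nat_mult: "coords (of_nat c * f) = int c \<cdot>\<^sub>v coords f"
proof -
  have "top_coeff (zpow j * (of_nat c * f)) = int c * top_coeff (zpow j * f)" for j
    by (induction c) (simp_all add: top_coeff_add top_coeff_multiple distrib_left distrib_right)
  then show ?thesis by (intro eq_vecI) (auto simp: coords_def)
qed

lemma range_coker_class_coords:
  assumes "M \<in> carrier_mat d d"
  shows "range (\<lambda>f. coker_class M (coords f)) = carrier (coker M)"
proof -
  have "range coords = carrier_vec d"
    using coords_surj by (force simp: image_iff)
  then show ?thesis by (simp add: coker_carrier[OF assms] flip: image_image)
qed

text \<open>\<open>coords\<close> identifies the quotient by \<open>P\<close> with the integer
  vectors, and \<open>M\<close> is multiplication by \<open>E\<close> on it, so passing to the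
  cokernel adds \<open>E\<close> to the ideal.\<close>

lemma coker_class_coords_eq_iff:
  assumes M: "M \<in> carrier_mat d d" "\<And>f. M *\<^sub>v coords f = coords (E * f)"
  shows "coker_class M (coords f) = coker_class M (coords g) \<longleftrightarrow> (\<exists>q. P dvd (f - g) - E * q)"
proof -
  have "coker_class M (coords f) = coker_class M (coords g) \<longleftrightarrow>
      (\<exists>w\<in>carrier_vec d. M *\<^sub>v w = coords f - coords g)"
    by (rule coker_class_eq_iff[OF M(1) coords_carrier coords_carrier])
  also have "\<dots> \<longleftrightarrow> (\<exists>q. M *\<^sub>v coords q = coords f - coords g)"
    using coords_surj coords_carrier by metis
  also have "\<dots> \<longleftrightarrow> (\<exists>q. coords ((f - g) - E * q) = 0\<^sub>v d)"
    unfolding M(2) coords_diff by (intro ex_cong1) (auto simp: vec_eq_iff)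
  finally show ?thesis by (simp only: coords_eq_0_iff)
qed

end

locale circulant_jumps =
  fixes k n :: nat and s :: "nat \<Rightarrow> nat"
  assumes k_pos: "1 \<le> k" and s_pos: "1 \<le> s 1"
    and s_mono: "strict_mono_on {1..k} s" and s_less: "s k < n"
begin

lemma s_bounds: "1 \<le> s j \<and> s j \<le> s k" if "j \<in> {1..k}"
  using that k_pos s_pos strict_mono_on_leD[OF s_mono, of 1 j] strict_mono_on_leD[OF s_mono, of j k]
  by simp

lemma inj_on_s: "inj_on s {1..k}"
  using s_mono by (rule strict_mono_on_imp_inj_on)

sublocale circulant_shifts n "s ` {1..k}"
  by unfold_locales (use s_less s_bounds in force)+

text \<open>The polynomial \<open>Q\<close> of the overview.\<close>

definition jump_poly :: laurent_poly where
  "jump_poly = of_nat (2 * k + 2) - (\<Sum>j=1..k. zpow (int (s j)) + zpow (- int (s j)))"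

lemma lattice_poly_eq: "lattice_poly = jump_poly - zpow (int n)"
  unfolding lattice_poly_def jump_poly_def sum_shifts
  by (simp add: card_image inj_on_s sum.reindex del: One_nat_def)

section \<open>Extreme coefficients and span of the characteristic polynomial\<close>

lemma lookup_jump_poly:
  "lookup jump_poly i = int (2 * k + 2) * of_bool (i = 0)
    - (\<Sum>j=1..k. of_bool (i = int (s j)) + of_bool (i = - int (s j)))"
  unfolding jump_poly_def lookup_minus lookup_sum lookup_add lookup_zpow lookup_of_nat
  by (simp add: when_def)

lemma keys_jump_poly: "keys jump_poly \<subseteq> {- int (s k)..int (s k)}"
  unfolding keys_subset_iff
proof (intro allI impI)
  fix i assume i: "i \<notin> {- int (s k)..int (s k)}"
  have "i \<noteq> int (s j) \<and> i \<noteq> - int (s j)" if "j \<in> {1..k}" for j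
    using i s_bounds[OF that] by auto
  then have "(\<Sum>j=1..k. of_bool (i = int (s j)) + of_bool (i = - int (s j))) = (0 :: int)"
    by (intro sum.neutral) auto
  moreover have "i \<noteq> 0" using i by auto
  ultimately show "lookup jump_poly i = 0" by (simp add: lookup_jump_poly)
qed

text \<open>By strict monotonicity only the jump \<open>s k\<close> reaches the two ends, and since
  it is positive, the constant term does not interfere.\<close>

lemma lookup_jump_poly_ends:
  assumes "i = int (s k) \<or> i = - int (s k)"
  shows "lookup jump_poly i = - 1"
proof -
  have k: "k \<in> {1..k}" using k_pos by simp
  have "of_bool (i = int (s j)) + of_bool (i = - int (s j)) = (if j = k then 1 else 0 :: int)"
    if j: "j \<in> {1..k}" for j
  proof (cases "j = k")
    case False
    then have "s j \<noteq> s k" using inj_on_s j k by (auto dest: inj_onD)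
    then show ?thesis using assms False s_bounds[OF j] by auto
  qed (use assms s_bounds[OF j] in auto)
  then have "(\<Sum>j=1..k. of_bool (i = int (s j)) + of_bool (i = - int (s j))) =
      (\<Sum>j=1..k. if j = k then 1 else 0 :: int)"
    by (intro sum.cong) auto
  also have "\<dots> = 1" using k by simp
  finally show ?thesis
    using assms s_bounds[OF k] by (auto simp: lookup_jump_poly)
qed

definition char_laurent :: laurent_poly where
  "char_laurent = jump_poly\<^sup>2 - 1"

lemma keys_char_laurent: "keys char_laurent \<subseteq> {- 2 * int (s k)..2 * int (s k)}"
proof -
  have "keys (jump_poly\<^sup>2) \<subseteq> {- 2 * int (s k)..2 * int (s k)}"
    using keys_mult_interval[OF keys_jump_poly keys_jump_poly] by (simp add: power2_eq_square)
  moreover have "keys 1 \<subseteq> {- 2 * int (s k)..2 * int (s k)}" by simp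
  ultimately show ?thesis
    unfolding char_laurent_def using keys_diff[of "jump_poly\<^sup>2" 1] by blast
qed

text \<open>Squaring turns the extreme coefficients -1 into 1; subtracting 1 touches only exponent
  0, which lies strictly between the ends.\<close>

lemma lookup_char_laurent_ends:
  "lookup char_laurent (2 * int (s k)) = 1" "lookup char_laurent (- 2 * int (s k)) = 1"
proof -
  have "s k > 0" using s_bounds[of k] k_pos by simp
  then show "lookup char_laurent (2 * int (s k)) = 1" "lookup char_laurent (- 2 * int (s k)) = 1"
    using lookup_mult_upper[OF keys_jump_poly keys_jump_poly]
      lookup_mult_lower[OF keys_jump_poly keys_jump_poly]
    by (simp_all add: char_laurent_def lookup_minus lookup_one power2_eq_square lookup_jump_poly_ends)
qed

lemma low_exp_char_laurent: "low_exp char_laurent = - 2 * int (s k)"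
  unfolding low_exp_def
proof (rule Min_eqI)
  show "- 2 * int (s k) \<in> keys char_laurent"
    using lookup_char_laurent_ends(2) by (simp add: in_keys_iff)
qed (use keys_char_laurent in auto)

lemma laurent_span_char_laurent: "laurent_span char_laurent = 4 * s k"
proof -
  have "Max (keys char_laurent) = 2 * int (s k)"
  proof (rule Max_eqI)
    show "2 * int (s k) \<in> keys char_laurent"
      using lookup_char_laurent_ends(1) by (simp add: in_keys_iff)
  qed (use keys_char_laurent in auto)
  then show ?thesis by (simp add: laurent_span_def low_exp_char_laurent)
qed

text \<open>The monomial factor moves the lowest exponent to 0 and changes neither the ideal nor the
  companion matrix.\<close>

sublocale bimonic "zpow (2 * int (s k)) * char_laurent" "4 * s k"
proof
  show "0 < 4 * s k" using s_bounds[of k] k_pos by simp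
  have "lookup char_laurent i = 0" if "i \<notin> {- 2 * int (s k)..2 * int (s k)}" for i
    using that keys_char_laurent unfolding keys_subset_iff by blast
  then show "keys (zpow (2 * int (s k)) * char_laurent) \<subseteq> {0..int (4 * s k)}"
    unfolding keys_subset_iff by auto
qed (use lookup_char_laurent_ends in simp_all)

lemma companion_mat_char_laurent: "companion_mat char_laurent = companion"
  unfolding companion_mat_def companion_def laurent_span_char_laurent low_exp_char_laurent
  by (intro cong_mat) (auto simp: add.commute)

definition jac_mat :: "int mat" where
  "jac_mat = mat_zpow companion (int n) - int (2 * k + 2) \<cdot>\<^sub>m 1\<^sub>m (4 * s k)
    + mat_sum (4 * s k) (\<lambda>j. mat_zpow companion (int (s j)) + mat_zpow companion (- int (s j))) {1..k}"

lemma jac_mat_carrier: "jac_mat \<in> carrier_mat (4 * s k) (4 * s k)"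
  and jac_mat_coords: "jac_mat *\<^sub>v coords f = coords (- lattice_poly * f)"
proof -
  let ?d = "4 * s k"
  let ?F = "\<lambda>j. mat_zpow companion (int (s j)) + mat_zpow companion (- int (s j))"
  let ?p = "\<lambda>j. zpow (int (s j)) + zpow (- int (s j))"
  have F: "?F j \<in> carrier_mat ?d ?d" for j
    by (intro add_carrier_mat mat_zpow_carrier)
  have F_coords: "?F j *\<^sub>v coords f = coords (?p j * f)" for j f
    by (simp only: add_mult_distrib_mat_vec[OF mat_zpow_carrier mat_zpow_carrier coords_carrier]
        mat_zpow_coords distrib_right coords_add)
  note sum = mat_sum_coords[of "{1..k}" ?F ?p, OF finite_atLeastAtMost F F_coords]
  have one: "int (2 * k + 2) \<cdot>\<^sub>m 1\<^sub>m ?d \<in> carrier_mat ?d ?d" by simp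
  have diff: "mat_zpow companion (int n) - int (2 * k + 2) \<cdot>\<^sub>m 1\<^sub>m ?d \<in> carrier_mat ?d ?d"
    using one by (rule minus_carrier_mat)
  show "jac_mat \<in> carrier_mat ?d ?d"
    unfolding jac_mat_def using diff sum(1) by (intro add_carrier_mat)
  have "jac_mat *\<^sub>v coords f = coords (zpow (int n) * f) - coords (of_nat (2 * k + 2) * f)
      + coords ((\<Sum>j=1..k. ?p j) * f)"
    unfolding jac_mat_def add_mult_distrib_mat_vec[OF diff sum(1) coords_carrier]
      minus_mult_distrib_mat_vec[OF mat_zpow_carrier one coords_carrier] sum(2) mat_zpow_coords
      smult_one_mult_vec[OF coords_carrier] coords_of_nat_mult ..
  also have "\<dots> = coords (- lattice_poly * f)"
    unfolding lattice_poly_eq jump_poly_def coords_diff[symmetric] coords_add[symmetric]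
    by (simp add: algebra_simps)
  finally show "jac_mat *\<^sub>v coords f = coords (- lattice_poly * f)" .
qed

section \<open>Equality of the two ideals and the isomorphism\<close>

lemma jac_class_eq_iff_coker_class:
  "jac_class f = jac_class g \<longleftrightarrow> coker_class jac_mat (coords f) = coker_class jac_mat (coords g)"
proof -
  have "char_laurent - (zpow (2 * int n) - 1) = lattice_poly * (jump_poly + zpow (int n))"
    unfolding lattice_poly_eq char_laurent_def by (simp add: power2_eq_square algebra_simps zpow_mult)
  then have "jac_class f = jac_class g \<longleftrightarrow> (\<exists>q. char_laurent dvd (f - g) - lattice_poly * q)"
    using ex_dvd_modulo_cong[of char_laurent "zpow (2 * int n) - 1"] jac_class_eq_iff by metis
  \<comment> \<open>The matrix is multiplication by \<open>- lattice_poly\<close>; replacing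
    \<open>q\<close> by \<open>- q\<close> absorbs the sign.\<close>
  also have "\<dots> \<longleftrightarrow> (\<exists>q. char_laurent dvd (f - g) - - lattice_poly * q)"
    by (metis minus_mult_minus minus_minus)
  also have "\<dots> \<longleftrightarrow> coker_class jac_mat (coords f) = coker_class jac_mat (coords g)"
    using coker_class_coords_eq_iff[OF jac_mat_carrier jac_mat_coords, of f g]
    by (simp only: zpow_mult_dvd_iff)
  finally show ?thesis .
qed

lemma Jac_Cone_iso: "Jac Cone \<cong> coker jac_mat"
proof (rule iso_if_common_parametrization)
  show "coker_class jac_mat (coords (f + g)) =
      coker_class jac_mat (coords f) \<otimes>\<^bsub>coker jac_mat\<^esub> coker_class jac_mat (coords g)" for f g
    unfolding coords_add by (rule coker_class_add[OF jac_mat_carrier coords_carrier coords_carrier])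
qed (rule range_jac_class range_coker_class_coords[OF jac_mat_carrier] jac_class_add
      jac_class_eq_iff_coker_class)+

end

theorem theorem4:
  fixes k n :: nat and s :: "nat \<Rightarrow> nat"
  assumes "1 \<le> k"
    and "1 \<le> s 1"
    and "strict_mono_on {1..k} s"
    and "s k < n"
  shows "let G = circulant_graph (2 * n) (s ` {1..k} \<union> {n});
             P = (of_nat (2 * k + 2) - (\<Sum>j=1..k. zpow (int (s j)) + zpow (- int (s j))))\<^sup>2 - 1;
             A = companion_mat P;
             d = dim_row A
         in Jac (cone_graph (2 * n) G) \<cong>
            coker (mat_zpow A (int n) - int (2 * k + 2) \<cdot>\<^sub>m 1\<^sub>m d
                   + mat_sum d (\<lambda>j. mat_zpow A (int (s j)) + mat_zpow A (- int (s j))) {1..k})"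
proof -
  interpret circulant_jumps k n s
    using assms by unfold_locales
  have "companion_mat ((of_nat (2 * k + 2) - (\<Sum>j=1..k. zpow (int (s j)) + zpow (- int (s j))))\<^sup>2 - 1)
      = companion"
    using companion_mat_char_laurent by (simp only: char_laurent_def jump_poly_def)
  moreover have "dim_row companion = 4 * s k"
    using companion_carrier(1) by (rule carrier_matD(1))
  ultimately show ?thesis
    using Jac_Cone_iso unfolding Cone_def jac_mat_def Let_def by (simp only:)
qed

end
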